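(* Let $(E_1,d_1)$ and $(E_2,d_2)$ be Polish spaces with Borel $\sigma$-algebras $\mathcal{E}_1,\mathcal{E}_2$, and let $(X_n)$ and $(Y_n)$ be sequences of random elements of $E_1$ and $E_2$ respectively, all defined on one probability space. Let $\Pi$ be the set of all product measures $\mu_1\times\mu_2$ with $\mu_1$ a probability measure on $\mathcal{E}_1$ and $\mu_2$ a probability measure on $\mathcal{E}_2$. Then condition AI-1 is equivalent to $$\pi(P_{(X_n,Y_n)},\Pi)\to 0,\qquad n\to+\infty,$$ where $\pi(\mu,\Pi)=\inf_{\nu\in\Pi}\pi(\mu,\nu)$ and $\pi$ is the Lévy–Prokhorov metric on probability measures on $E_1\times E_2$.
   Context: $d_1,d_2$ are complete separable metrics, and $E_1\times E_2$ carries the metric $d((x_1,y_1),(x_2,y_2))=d_1(x_1,x_2)+d_2(y_1,y_2)$ (or, equivalently, the maximum metric). $P_\xi$ denotes the distribution of a random element $\xi$. The Lévy–Prokhorov metric is $\pi(\mu,\nu)=\inf\{\varepsilon>0:\mu(A^{\varepsilon})\le\nu(A)+\varepsilon\text{ for all closed sets }A\}$, up to the (immaterial) order of $\mu,\nu$; i.e. the standard Lévy–Prokhorov metric $\inf\{\varepsilon>0:\mu(A)\le\nu(A^{\varepsilon})+\varepsilon\text{ for all closed }A\}$, where $A^\varepsilon$ is the $\varepsilon$-neighbourhood of $A$. AI-1: for all bounded uniformly continuous functions $h:E_1\times E_2\to\mathbb{R}$, $\int h(x,y)\,P_{(X_n,Y_n)}(dx,dy)-\int h(x,y)\,(P_{X_n}\times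 P_{Y_n})(dx,dy)\to 0$ as $n\to+\infty$. *)

theory Defs
  imports "HOL-Probability.Probability"
begin

(* The library's metric on a product type is the Euclidean combination of the two
   distances, hence the separate metric object. *)
definition sum_metric :: "('a::metric_space \<times> 'b::metric_space) metric" where
  "sum_metric = metric (UNIV, \<lambda>p q. dist (fst p) (fst q) + dist (snd p) (snd q))"

lemma Metric_space_sum_dist:
  "Metric_space UNIV
    (\<lambda>p q. dist (fst p) (fst q :: 'a::metric_space) + dist (snd p) (snd q :: 'b::metric_space))"
proof
  fix p q r :: "'a \<times> 'b"
  show "0 \<le> dist (fst p) (fst q) + dist (snd p) (snd q)"
    by simp
  show "dist (fst p) (fst q) + dist (snd p) (snd q) =
      dist (fst q) (fst p) + dist (snd q) (snd p)"
    by (simp add: dist_commute)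
  show "dist (fst p) (fst q) + dist (snd p) (snd q) = 0 \<longleftrightarrow> p = q"
    by (simp add: add_nonneg_eq_0_iff prod_eq_iff)
  show "dist (fst p) (fst r) + dist (snd p) (snd r) \<le>
      dist (fst p) (fst q) + dist (snd p) (snd q) +
      (dist (fst q) (fst r) + dist (snd q) (snd r))"
    using dist_triangle[of "fst p" "fst r" "fst q"] dist_triangle[of "snd p" "snd r" "snd q"]
    by linarith
qed

lemma mspace_sum_metric [simp]: "mspace sum_metric = UNIV"
  and mdist_sum_metric [simp]:
    "mdist sum_metric p q = dist (fst p) (fst q) + dist (snd p) (snd q)"
  by (simp_all add: sum_metric_def Metric_space.mspace_metric[OF Metric_space_sum_dist]
      Metric_space.mdist_metric[OF Metric_space_sum_dist])

lemma mtopology_of_sum_metric [simp]: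
  "mtopology_of (sum_metric :: ('a::metric_space \<times> 'b::metric_space) metric) = euclidean"
proof (rule topology_eq[THEN iffD2], intro allI)
  fix S :: "('a \<times> 'b) set"
  have le: "dist p q \<le> dist (fst p) (fst q) + dist (snd p) (snd q)" for p q :: "'a \<times> 'b"
    unfolding dist_prod_def by (rule sqrt_sum_squares_le_sum) simp_all
  have ge: "dist (fst p) (fst q) + dist (snd p) (snd q) \<le> 2 * dist p q" for p q :: "'a \<times> 'b"
    using dist_fst_le[of p q] dist_snd_le[of p q] by linarith
  have mball: "q \<in> Metric_space.mball UNIV (mdist sum_metric) p r \<longleftrightarrow>
      dist (fst p) (fst q) + dist (snd p) (snd q) < r" for p q :: "'a \<times> 'b" and r
    using Metric_space.in_mball[OF Metric_space_mspace_mdist[of sum_metric], of q p r] by simp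
  have "openin (mtopology_of sum_metric) S \<longleftrightarrow>
      (\<forall>p\<in>S. \<exists>r>0. \<forall>q. dist (fst p) (fst q) + dist (snd p) (snd q) < r \<longrightarrow> q \<in> S)"
    unfolding mtopology_of_def
    by (subst Metric_space.openin_mtopology[OF Metric_space_mspace_mdist])
      (simp add: subset_iff mball Ball_def del: split_paired_All)
  also have "\<dots> \<longleftrightarrow> (\<forall>p\<in>S. \<exists>r>0. \<forall>q. dist q p < r \<longrightarrow> q \<in> S)"
  proof (intro ball_cong refl iffI)
    fix p
    assume "\<exists>r>0. \<forall>q. dist (fst p) (fst q) + dist (snd p) (snd q) < r \<longrightarrow> q \<in> S"
    then obtain r where "r > 0"
      and r: "\<And>q. dist (fst p) (fst q) + dist (snd p) (snd q) < r \<Longrightarrow> q \<in> S"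
      by blast
    have "q \<in> S" if "dist q p < r / 2" for q
      by (rule r) (use that ge[of p q] in \<open>simp add: dist_commute\<close>)
    with \<open>r > 0\<close> show "\<exists>r>0. \<forall>q. dist q p < r \<longrightarrow> q \<in> S"
      by (intro exI[of _ "r / 2"]) simp
  next
    fix p
    assume "\<exists>r>0. \<forall>q. dist q p < r \<longrightarrow> q \<in> S"
    then show "\<exists>r>0. \<forall>q. dist (fst p) (fst q) + dist (snd p) (snd q) < r \<longrightarrow> q \<in> S"
      by (metis le dist_commute order_le_less_trans)
  qed
  also have "\<dots> \<longleftrightarrow> openin euclidean S"
    by (simp add: open_dist)
  finally show "openin (mtopology_of sum_metric) S = openin euclidean S" .
qed

definition metric_nbhd :: "'a metric \<Rightarrow> 'a set \<Rightarrow> real \<Rightarrow> 'a set" where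
  "metric_nbhd m A \<epsilon> = (\<Union>x\<in>A. mball_of m x \<epsilon>)"

definition levy_prokhorov :: "'a metric \<Rightarrow> 'a measure \<Rightarrow> 'a measure \<Rightarrow> real" where
  "levy_prokhorov m \<mu> \<nu> =
    Inf {\<epsilon>. 0 < \<epsilon> \<and>
      (\<forall>A. closedin (mtopology_of m) A \<longrightarrow>
        measure \<mu> A \<le> measure \<nu> (metric_nbhd m A \<epsilon>) + \<epsilon>)}"

definition product_laws :: "('a::topological_space \<times> 'b::topological_space) measure set" where
  "product_laws =
    {\<mu>\<^sub>1 \<Otimes>\<^sub>M \<mu>\<^sub>2 | \<mu>\<^sub>1 \<mu>\<^sub>2.
      prob_space \<mu>\<^sub>1 \<and> sets \<mu>\<^sub>1 = sets borel \<and>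
      prob_space \<mu>\<^sub>2 \<and> sets \<mu>\<^sub>2 = sets borel}"

definition joint_law ::
  "'w measure \<Rightarrow> ('w \<Rightarrow> 'a::topological_space) \<Rightarrow> ('w \<Rightarrow> 'b::topological_space) \<Rightarrow>
    ('a \<times> 'b) measure" where
  "joint_law M X Y = distr M (borel \<Otimes>\<^sub>M borel) (\<lambda>\<omega>. (X \<omega>, Y \<omega>))"

definition AI1 ::
  "'w measure \<Rightarrow> (nat \<Rightarrow> 'w \<Rightarrow> 'a::metric_space) \<Rightarrow> (nat \<Rightarrow> 'w \<Rightarrow> 'b::metric_space) \<Rightarrow> bool" where
  "AI1 M X Y \<longleftrightarrow>
    (\<forall>h :: 'a \<times> 'b \<Rightarrow> real.
      bounded (range h) \<and> uniformly_continuous_map sum_metric euclidean_metric h \<longrightarrow>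
      (\<lambda>n. (\<integral>p. h p \<partial>(joint_law M (X n) (Y n))) -
           (\<integral>p. h p \<partial>(distr M borel (X n) \<Otimes>\<^sub>M distr M borel (Y n)))) \<longlonglongrightarrow> 0)"

end

theory Submission
  imports Defs "HOL-Complex_Analysis.Great_Picard"
begin

text \<open>
  Write \<open>P n\<close> for the joint law of \<open>X n\<close> and \<open>Y n\<close>, and \<open>Q n\<close> for the product of its marginals.

  If the distance of \<open>P n\<close> to the product laws is less than \<open>\<delta>\<close>, some product \<open>\<alpha> \<Otimes>\<^sub>M \<beta>\<close> satisfies
  the Levy-Prokhorov inequality with some \<open>\<epsilon> < \<delta>\<close>. A layer-cake argument turns this inequality into a
  bound \<open>\<omega> + 4 * C * \<epsilon>\<close> for the difference of the integrals of any function bounded by \<open>C\<close> that varies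
  by at most \<open>\<omega>\<close> over distances below \<open>\<epsilon>\<close> (\<open>integral_near_of_nbhd_le\<close>). Applied to \<open>h\<close> and to its
  sections in either variable, it shows that \<open>P n\<close> is close to \<open>\<alpha> \<Otimes>\<^sub>M \<beta>\<close>, that the marginals are
  close to \<open>\<alpha>\<close> and \<open>\<beta>\<close>, and hence by Fubini that \<open>P n\<close> is close to \<open>Q n\<close>
  (\<open>integral_joint_near_marginals\<close>).

  For the converse, the distance of \<open>P n\<close> to the product laws is at most its distance to \<open>Q n\<close>, and
  no structure of these measures matters any more: if \<open>\<integral>h dP n - \<integral>h dQ n\<close> tends to \<open>0\<close> for every fixed
  bounded Lipschitz function \<open>h\<close>, then it does so uniformly over all \<open>L\<close>-Lipschitz functions with values in
  \<open>[0, 1]\<close> (\<open>lipschitz_close_uniform\<close>), and Lipschitz approximations of indicators of closed sets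
  conclude. As the laws need not be tight, uniformity cannot come from compactness of a common support. It
  is a Schur-type property. Given \<open>L\<close>-Lipschitz functions \<open>f n\<close>, a subsequence converges pointwise to
  some \<open>F\<close>. The limit is a single test function, hence harmless, and after subtracting it and
  truncating small values the functions eventually vanish near each point. If their integrals did not
  become close, a subsequence with disjoint supports could be glued to one Lipschitz function that
  contradicts the hypothesis (\<open>gliding_hump\<close>).
\<close>

section \<open>Borel probability measures and Lipschitz functions\<close>

text \<open>A Borel probability measure. Only the \<open>\<sigma>\<close>-algebra is pinned down; it determines the
  underlying space.\<close>

definition borel_prob :: "'c::topological_space measure \<Rightarrow> bool" where
  "borel_prob P \<longleftrightarrow> prob_space P \<and> sets P = sets borel"

text \<open>Asymptotic closeness of two sequences of measures, tested one fixed bounded Lipschitz function at a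
  time. Neither sequence is required to converge or to be tight.\<close>

definition lipschitz_close ::
  "(nat \<Rightarrow> 'c::metric_space measure) \<Rightarrow> (nat \<Rightarrow> 'c measure) \<Rightarrow> bool" where
  "lipschitz_close P Q \<longleftrightarrow>
    (\<forall>(h :: 'c \<Rightarrow> real) L. L-lipschitz_on UNIV h \<and> bounded (range h) \<longrightarrow>
      (\<lambda>n. (\<integral>x. h x \<partial>P n) - (\<integral>x. h x \<partial>Q n)) \<longlonglongrightarrow> 0)"

lemma borel_prob_integrable:
  fixes f :: "'c::topological_space \<Rightarrow> real"
  assumes P: "borel_prob P" and f: "f \<in> borel_measurable borel" and bd: "\<And>x. \<bar>f x\<bar> \<le> C"
  shows "integrable P f"
proof -
  interpret prob_space P using P by (simp add: borel_prob_def)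
  have "f \<in> borel_measurable P"
    using P f by (simp add: borel_prob_def cong: measurable_cong_sets)
  then show ?thesis
    by (intro integrable_const_bound[where B=C]) (auto simp: bd)
qed

lemma borel_prob_integral_near:
  fixes f g :: "'c::topological_space \<Rightarrow> real"
  assumes P: "borel_prob P"
    and f: "f \<in> borel_measurable borel" "\<And>x. \<bar>f x\<bar> \<le> C"
    and g: "g \<in> borel_measurable borel" "\<And>x. \<bar>g x\<bar> \<le> C"
    and near: "\<And>x. \<bar>f x - g x\<bar> \<le> \<eta>"
  shows "\<bar>(\<integral>x. f x \<partial>P) - (\<integral>x. g x \<partial>P)\<bar> \<le> \<eta>"
proof -
  interpret prob_space P using P by (simp add: borel_prob_def)
  note int = borel_prob_integrable[OF P f] borel_prob_integrable[OF P g]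
  have "(\<integral>x. f x \<partial>P) - (\<integral>x. g x \<partial>P) = (\<integral>x. f x - g x \<partial>P)"
    using int by simp
  moreover have "(\<integral>x. f x - g x \<partial>P) \<le> \<eta>"
    using int near by (intro integral_le_const) (auto simp: abs_le_iff)
  moreover have "-\<eta> \<le> (\<integral>x. f x - g x \<partial>P)"
  proof -
    have "-\<eta> \<le> f x - g x" for x using near[of x] by linarith
    then show ?thesis using int by (intro integral_ge_const) auto
  qed
  ultimately show ?thesis by linarith
qed

lemma borel_prob_integral_off_set:
  fixes f g :: "'c::topological_space \<Rightarrow> real"
  assumes P: "borel_prob P"
    and f: "f \<in> borel_measurable borel" "\<And>x. \<bar>f x\<bar> \<le> C"
    and g: "g \<in> borel_measurable borel" "\<And>x. \<bar>g x\<bar> \<le> C"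
    and near: "\<And>x. \<bar>f x - g x\<bar> \<le> 1"
    and N: "N \<in> sets borel" "measure P N \<le> \<delta>"
    and eq: "\<And>x. x \<notin> N \<Longrightarrow> f x = g x"
  shows "\<bar>(\<integral>x. f x \<partial>P) - (\<integral>x. g x \<partial>P)\<bar> \<le> \<delta>"
proof -
  interpret prob_space P using P by (simp add: borel_prob_def)
  have N': "N \<in> sets P" using P N by (simp add: borel_prob_def)
  note int = borel_prob_integrable[OF P f] borel_prob_integrable[OF P g]
  have "(\<integral>x. f x \<partial>P) - (\<integral>x. g x \<partial>P) = (\<integral>x. f x - g x \<partial>P)"
    using int by simp
  also have "\<bar>\<dots>\<bar> \<le> (\<integral>x. indicator N x \<partial>P)"
  proof -
    have "norm (\<integral>x. f x - g x \<partial>P) \<le> (\<integral>x. norm (f x - g x) \<partial>P)"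
      by (rule integral_norm_bound)
    also have "\<dots> \<le> (\<integral>x. indicator N x \<partial>P)"
      using int N' near eq
      by (intro integral_mono integrable_norm integrable_diff integrable_real_indicator)
        (auto simp: indicator_def emeasure_eq_measure)
    finally show ?thesis by simp
  qed
  also have "\<dots> = measure P N" using N' sets.sets_into_space[OF N'] by (simp add: Int_absorb2)
  finally show ?thesis using N by simp
qed

lemma lipschitz_on_UNIV_borel:
  fixes f :: "'c::metric_space \<Rightarrow> real"
  assumes "L-lipschitz_on UNIV f"
  shows "f \<in> borel_measurable borel"
  using assms by (intro borel_measurable_continuous_onI lipschitz_on_continuous_on)

lemma lipschitz_on_UNIV_iff_real:
  fixes f :: "'c::metric_space \<Rightarrow> real"
  shows "L-lipschitz_on UNIV f \<longleftrightarrow> 0 \<le> L \<and> (\<forall>x y. \<bar>f x - f y\<bar> \<le> L * dist x y)"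
  by (auto simp: lipschitz_on_def dist_real_def)

lemma scaled_infdist_diff_le:
  fixes c :: real
  assumes "0 \<le> c"
  shows "\<bar>c * infdist x A - c * infdist y A\<bar> \<le> c * dist x y"
proof -
  have "\<bar>c * infdist x A - c * infdist y A\<bar> = c * \<bar>infdist x A - infdist y A\<bar>"
    using assms by (simp only: right_diff_distrib[symmetric] abs_mult abs_of_nonneg)
  then show ?thesis
    by (simp only:) (intro mult_left_mono infdist_triangle_abs assms)
qed

lemma infdist_less_obtain:
  assumes "infdist x A < r" "A \<noteq> {}"
  obtains a where "a \<in> A" "dist x a < r"
proof -
  have "(INF a\<in>A. dist x a) < r" using assms by (simp add: infdist_notempty)
  then show ?thesis using that assms
    by (subst (asm) cINF_less_iff) auto
qed

lemma measurable_infdist_ge: "{x. \<rho> \<le> infdist x (A :: 'c::metric_space set)} \<in> sets borel"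
  by (intro borel_closed closed_Collect_le continuous_intros)

section \<open>Uniformity over Lipschitz functions\<close>

text \<open>Two Borel probability measures on a separable metric space are concentrated, up to \<open>\<delta>\<close>, on the
  \<open>\<rho>\<close>-neighbourhood of one finite set. This needs separability only, and replaces tightness, which
  would use completeness.\<close>

lemma finite_net_of_measures:
  fixes P Q :: "'c::{metric_space, second_countable_topology} measure"
  assumes P: "borel_prob P" and Q: "borel_prob Q" and "0 < \<rho>" "0 < \<delta>"
  obtains F where "finite F" "F \<noteq> {}"
    "measure P {x. \<rho> \<le> infdist x F} \<le> \<delta>" "measure Q {x. \<rho> \<le> infdist x F} \<le> \<delta>"
proof -
  obtain D :: "'c set" where D: "countable D" "\<And>U. open U \<Longrightarrow> U \<noteq> {} \<Longrightarrow> \<exists>d\<in>D. d \<in> U"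
    using countable_dense_setE by metis
  have Dne: "D \<noteq> {}" using D(2)[of UNIV] by auto
  define F where "F n = from_nat_into D ` {..n}" for n :: nat
  define B where "B n = {x. \<rho> \<le> infdist x (F n)}" for n
  have "decseq B"
    unfolding decseq_def B_def
  proof (intro allI impI subsetI CollectI)
    fix m n x assume "m \<le> (n::nat)" "x \<in> {x. \<rho> \<le> infdist x (F n)}"
    moreover have "F m \<subseteq> F n" "F m \<noteq> {}"
      using \<open>m \<le> n\<close> by (auto simp: F_def)
    ultimately show "\<rho> \<le> infdist x (F m)"
      using infdist_mono[of "F m" "F n" x] by auto
  qed
  have "(\<Inter>n. B n) = {}"
  proof safe
    fix x assume x: "x \<in> (\<Inter>n. B n)"
    obtain d where d: "d \<in> D" "d \<in> ball x \<rho>"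
      using D(2)[of "ball x \<rho>"] \<open>0 < \<rho>\<close> by auto
    then obtain n where "d = from_nat_into D n"
      using D(1) from_nat_into_surj by metis
    then have "infdist x (F n) \<le> dist x d"
      by (intro infdist_le) (auto simp: F_def)
    moreover have "\<rho> \<le> infdist x (F n)" using x by (auto simp: B_def)
    ultimately show "x \<in> {}" using d by simp
  qed
  have lim: "(\<lambda>n. measure R (B n)) \<longlonglongrightarrow> 0" if R: "borel_prob R" for R
  proof -
    interpret prob_space R using R by (simp add: borel_prob_def)
    have "range B \<subseteq> sets R"
      using R measurable_infdist_ge by (auto simp: borel_prob_def B_def)
    from finite_Lim_measure_decseq[OF this \<open>decseq B\<close>] show ?thesis
      by (simp add: \<open>(\<Inter>n. B n) = {}\<close>)
  qed
  from order_tendstoD(2)[OF lim[OF P] \<open>0 < \<delta>\<close>] order_tendstoD(2)[OF lim[OF Q] \<open>0 < \<delta>\<close>]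
  have "\<forall>\<^sub>F n in sequentially. measure P (B n) < \<delta> \<and> measure Q (B n) < \<delta>"
    by eventually_elim simp
  then obtain n where "measure P (B n) < \<delta>" "measure Q (B n) < \<delta>"
    using eventually_happens'[OF sequentially_bot] by blast
  then show ?thesis
    by (intro that[of "F n"]) (auto simp: F_def B_def)
qed

text \<open>The core of the argument. Let the Lipschitz functions \<open>p n\<close> eventually vanish on a ball of fixed
  radius \<open>\<rho>\<close> around each point. If \<open>\<integral>p n dP n - \<integral>p n dQ n\<close> did not tend to \<open>0\<close>, then a subsequence of
  them, cut off outside a neighbourhood of a finite set that carries nearly all the mass of \<open>P n\<close>
  and \<open>Q n\<close>, would have disjoint supports, and the supremum of the truncated functions would be one
  bounded Lipschitz function that violates \<open>lipschitz_close\<close>.\<close>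

lemma gliding_hump:
  fixes P Q :: "nat \<Rightarrow> 'c::{metric_space, second_countable_topology} measure"
    and p :: "nat \<Rightarrow> 'c \<Rightarrow> real"
  assumes P: "\<And>n. borel_prob (P n)" and Q: "\<And>n. borel_prob (Q n)"
    and close: "lipschitz_close P Q"
    and lip: "\<And>n. L-lipschitz_on UNIV (p n)"
    and p0: "\<And>n x. 0 \<le> p n x" and p1: "\<And>n x. p n x \<le> 1"
    and "0 < \<rho>"
    and vanish: "\<And>x. \<forall>\<^sub>F n in sequentially. \<forall>y. dist x y < \<rho> \<longrightarrow> p n y = 0"
  shows "(\<lambda>n. (\<integral>x. p n x \<partial>P n) - (\<integral>x. p n x \<partial>Q n)) \<longlonglongrightarrow> 0"
proof (rule ccontr)
  define \<nu> where "\<nu> n f = (\<integral>x. f x \<partial>P n) - (\<integral>x. f x \<partial>Q n)" for n and f :: "'c \<Rightarrow> real"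
  assume "\<not> (\<lambda>n. (\<integral>x. p n x \<partial>P n) - (\<integral>x. p n x \<partial>Q n)) \<longlonglongrightarrow> 0"
  then obtain c where "0 < c" and c: "\<exists>\<^sub>F n in sequentially. c \<le> \<bar>\<nu> n (p n)\<bar>"
    unfolding tendsto_iff \<nu>_def
    by (auto simp: frequently_def not_le)
  define \<delta> where "\<delta> = c / 16"
  have "0 < \<delta>" using \<open>0 < c\<close> by (simp add: \<delta>_def)
  have "\<forall>n. \<exists>F. finite F \<and> F \<noteq> {} \<and> measure (P n) {x. \<rho> / 4 \<le> infdist x F} \<le> \<delta> \<and>
      measure (Q n) {x. \<rho> / 4 \<le> infdist x F} \<le> \<delta>"
    using finite_net_of_measures[OF P Q _ \<open>0 < \<delta>\<close>, of "\<rho> / 4"] \<open>0 < \<rho>\<close>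
    by (metis divide_pos_pos zero_less_numeral)
  then obtain F where F: "\<And>n. finite (F n)" "\<And>n. F n \<noteq> {}"
    and FP: "\<And>n. measure (P n) {x. \<rho> / 4 \<le> infdist x (F n)} \<le> \<delta>"
    and FQ: "\<And>n. measure (Q n) {x. \<rho> / 4 \<le> infdist x (F n)} \<le> \<delta>"
    by metis
  \<comment> \<open>\<open>q n\<close> agrees with \<open>p n\<close> within distance \<open>\<rho> / 4\<close> of \<open>F n\<close> and vanishes beyond distance \<open>\<rho> / 2\<close>.\<close>
  define q where "q n x = min (p n x) (max 0 (2 - 4 / \<rho> * infdist x (F n)))" for n x
  define K where "K = max L (4 / \<rho>)"
  have K: "0 \<le> K" using \<open>0 < \<rho>\<close> by (simp add: K_def le_max_iff_disj)
  have q0: "0 \<le> q n x" and q1: "q n x \<le> 1" and qp: "q n x \<le> p n x" for n x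
    using p0[of n x] p1[of n x] by (auto simp: q_def)
  have q_lip: "K-lipschitz_on UNIV (q n)" for n
    unfolding lipschitz_on_UNIV_iff_real
  proof (intro conjI allI K)
    fix x y :: 'c
    have "\<bar>p n x - p n y\<bar> \<le> L * dist x y"
      using lip[of n] by (simp add: lipschitz_on_UNIV_iff_real)
    also have "\<dots> \<le> K * dist x y" by (intro mult_right_mono) (auto simp: K_def)
    finally have 1: "\<bar>p n x - p n y\<bar> \<le> K * dist x y" .
    have "\<bar>4 / \<rho> * infdist x (F n) - 4 / \<rho> * infdist y (F n)\<bar> \<le> 4 / \<rho> * dist x y"
      using \<open>0 < \<rho>\<close> by (intro scaled_infdist_diff_le) simp
    also have "\<dots> \<le> K * dist x y" by (intro mult_right_mono) (auto simp: K_def)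
    finally show "\<bar>q n x - q n y\<bar> \<le> K * dist x y"
      using 1 unfolding q_def by linarith
  qed
  have q_supp: "infdist x (F n) < \<rho> / 2" if "q n x \<noteq> 0" for n x
  proof (rule ccontr)
    assume "\<not> infdist x (F n) < \<rho> / 2"
    then have "2 - 4 / \<rho> * infdist x (F n) \<le> 0" using \<open>0 < \<rho>\<close> by (simp add: field_simps)
    then show False using that p0[of n x] by (simp add: q_def)
  qed
  have q_eq: "q n x = p n x" if "x \<notin> {x. \<rho> / 4 \<le> infdist x (F n)}" for n x
  proof -
    have "1 \<le> 2 - 4 / \<rho> * infdist x (F n)"
      using that \<open>0 < \<rho>\<close> by (simp add: field_simps)
    then show ?thesis using p1[of n x] by (simp add: q_def)
  qed
  have \<nu>_off: "\<bar>\<nu> n f - \<nu> n g\<bar> \<le> 2 * \<delta>"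
    if "f \<in> borel_measurable borel" "\<And>x. \<bar>f x\<bar> \<le> 1" "g \<in> borel_measurable borel" "\<And>x. \<bar>g x\<bar> \<le> 1"
      "\<And>x. \<bar>f x - g x\<bar> \<le> 1" "\<And>x. x \<notin> {x. \<rho> / 4 \<le> infdist x (F n)} \<Longrightarrow> f x = g x" for n f g
    using borel_prob_integral_off_set[OF P that(1-5) measurable_infdist_ge FP[of n] that(6)]
      borel_prob_integral_off_set[OF Q that(1-5) measurable_infdist_ge FQ[of n] that(6)]
    unfolding \<nu>_def by linarith

  \<comment> \<open>\<open>G m n\<close> says that \<open>n\<close> may follow any indices chosen from \<open>{..m}\<close>: the difference of the integrals
    of \<open>p n\<close> is large, \<open>p n\<close> vanishes near all earlier nets, and every sum of earlier functions has nearly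
    the same integral under \<open>P n\<close> and \<open>Q n\<close>. Quantifying over all subsets \<open>J\<close> of \<open>{..m}\<close> makes the
    condition independent of which indices were chosen, so that a plain iteration selects them.\<close>
  define G where "G m n \<longleftrightarrow> c \<le> \<bar>\<nu> n (p n)\<bar> \<and>
      (\<forall>j\<le>m. \<forall>y. infdist y (F j) < \<rho> \<longrightarrow> p n y = 0) \<and>
      (\<forall>J\<subseteq>{..m}. \<bar>\<nu> n (\<lambda>x. \<Sum>j\<in>J. q j x)\<bar> < c / 8)" for m n
  have "\<exists>n>m. G m n" for m
  proof -
    have "\<forall>\<^sub>F n in sequentially. \<forall>y. infdist y (F j) < \<rho> \<longrightarrow> p n y = 0" for j
    proof -
      have "\<forall>\<^sub>F n in sequentially. \<forall>x\<in>F j. \<forall>y. dist x y < \<rho> \<longrightarrow> p n y = 0"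
        using F(1) vanish by (intro eventually_ball_finite) auto
      then show ?thesis
        by eventually_elim (metis infdist_less_obtain F(2) dist_commute)
    qed
    then have "\<forall>\<^sub>F n in sequentially. \<forall>j\<in>{..m}. \<forall>y. infdist y (F j) < \<rho> \<longrightarrow> p n y = 0"
      by (intro eventually_ball_finite) auto
    moreover have "\<forall>\<^sub>F n in sequentially. \<bar>\<nu> n (\<lambda>x. \<Sum>j\<in>J. q j x)\<bar> < c / 8" if "J \<subseteq> {..m}" for J
    proof -
      have J: "finite J" using that finite_subset by blast
      have "(card J * K)-lipschitz_on UNIV (\<lambda>x. \<Sum>j\<in>J. q j x)"
        unfolding lipschitz_on_UNIV_iff_real
      proof (intro conjI allI)
        fix x y
        have "\<bar>(\<Sum>j\<in>J. q j x) - (\<Sum>j\<in>J. q j y)\<bar> \<le> (\<Sum>j\<in>J. \<bar>q j x - q j y\<bar>)"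
          by (subst sum_subtractf[symmetric]) (rule sum_abs)
        also have "\<dots> \<le> (\<Sum>j\<in>J. K * dist x y)"
          using q_lip by (intro sum_mono) (simp add: lipschitz_on_UNIV_iff_real)
        finally show "\<bar>(\<Sum>j\<in>J. q j x) - (\<Sum>j\<in>J. q j y)\<bar> \<le> card J * K * dist x y" by simp
      qed (use K in simp)
      moreover have "bounded (range (\<lambda>x. \<Sum>j\<in>J. q j x))"
      proof (intro boundedI)
        fix z assume "z \<in> range (\<lambda>x. \<Sum>j\<in>J. q j x)"
        then obtain x where z: "z = (\<Sum>j\<in>J. q j x)" by auto
        show "norm z \<le> card J"
          unfolding z real_norm_def using q0 q1 by (simp add: sum_nonneg sum_bounded_above[where K=1, simplified])
      qed
      ultimately have "(\<lambda>n. \<nu> n (\<lambda>x. \<Sum>j\<in>J. q j x)) \<longlonglongrightarrow> 0"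
        using close unfolding lipschitz_close_def \<nu>_def by blast
      from tendstoD[OF this, of "c / 8"] show ?thesis using \<open>0 < c\<close> by simp
    qed
    then have "\<forall>\<^sub>F n in sequentially. \<forall>J\<in>Pow {..m}. \<bar>\<nu> n (\<lambda>x. \<Sum>j\<in>J. q j x)\<bar> < c / 8"
      by (intro eventually_ball_finite) auto
    ultimately have "\<forall>\<^sub>F n in sequentially. n > m \<and>
        (\<forall>j\<in>{..m}. \<forall>y. infdist y (F j) < \<rho> \<longrightarrow> p n y = 0) \<and>
        (\<forall>J\<in>Pow {..m}. \<bar>\<nu> n (\<lambda>x. \<Sum>j\<in>J. q j x)\<bar> < c / 8)"
      by (intro eventually_conj eventually_gt_at_top)
    from frequently_eventually_frequently[OF c this]
    have "\<exists>\<^sub>F n in sequentially. n > m \<and> G m n"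
      by (rule frequently_elim1) (auto simp: G_def)
    then show ?thesis by (auto dest: frequently_ex)
  qed
  then obtain g where g: "\<And>m. m < g m" "\<And>m. G m (g m)" by metis
  define s where "s k = (g ^^ k) 0" for k
  define r where "r k = s (Suc k)" for k
  have "strict_mono s" by (rule strict_monoI_Suc) (simp add: s_def g)
  have "strict_mono r"
    using \<open>strict_mono s\<close> by (auto simp: r_def strict_mono_def)
  have Gr: "G (s k) (r k)" for k using g(2)[of "s k"] by (simp add: r_def s_def)
  have rs: "r j \<le> s k" if "j < k" for j k
    using \<open>strict_mono s\<close> that by (simp add: r_def strict_mono_less_eq Suc_leI)
  have zero: "q (r k) x = 0" if "j < k" "infdist x (F (r j)) < \<rho>" for j k x
    using Gr[of k] rs[OF that(1)] that(2) q0[of "r k" x] qp[of "r k" x] by (force simp: G_def)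
  have uniq: "q (r j) x = 0" if "q (r i) x \<noteq> 0" "j \<noteq> i" for i j x
  proof (rule ccontr)
    assume "q (r j) x \<noteq> 0"
    then have "infdist x (F (r j)) < \<rho>" "infdist x (F (r i)) < \<rho>"
      using q_supp[of "r i" x] q_supp[of "r j" x] that(1) \<open>0 < \<rho>\<close> by auto
    with \<open>q (r j) x \<noteq> 0\<close> zero[of j i x] zero[of i j x] that show False
      by (cases "j < i") auto
  qed

  \<comment> \<open>A supremum of \<open>K\<close>-Lipschitz functions is \<open>K\<close>-Lipschitz; by \<open>uniq\<close> it is also their sum.\<close>
  define h where "h x = (SUP k. q (r k) x)" for x
  have bdd: "bdd_above (range (\<lambda>k. q (r k) x))" for x using q1 by (rule bdd_aboveI2)
  have h_ge: "q (r k) x \<le> h x" for k x unfolding h_def by (rule cSUP_upper[OF _ bdd]) simp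
  have h_le: "h x \<le> a" if "\<And>k. q (r k) x \<le> a" for x a
    unfolding h_def using that by (intro cSUP_least) auto
  have h0: "0 \<le> h x" for x using h_ge[of 0 x] q0[of "r 0" x] by linarith
  have h1: "h x \<le> 1" for x using q1 by (rule h_le)
  have h_lip: "K-lipschitz_on UNIV h"
    unfolding lipschitz_on_UNIV_iff_real
  proof (intro conjI allI K)
    have "h x \<le> h y + K * dist x y" for x y
    proof (rule h_le)
      fix k
      have "\<bar>q (r k) x - q (r k) y\<bar> \<le> K * dist x y"
        using q_lip[of "r k"] by (simp add: lipschitz_on_UNIV_iff_real)
      then show "q (r k) x \<le> h y + K * dist x y" using h_ge[of k y] by linarith
    qed
    from this this[of y x for x y] show "\<bar>h x - h y\<bar> \<le> K * dist x y" for x y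
      by (smt (verit) dist_commute)
  qed
  have "(\<lambda>n. \<nu> n h) \<longlonglongrightarrow> 0"
  proof -
    have "bounded (range h)" using h0 h1 by (intro boundedI[where B=1]) auto
    then show ?thesis using h_lip close unfolding lipschitz_close_def \<nu>_def by blast
  qed
  then have "\<forall>\<^sub>F n in sequentially. \<bar>\<nu> n h\<bar> < c / 2"
    using \<open>0 < c\<close> by (auto dest: tendstoD[where e="c / 2"])
  then have "\<forall>\<^sub>F k in sequentially. \<bar>\<nu> (r k) h\<bar> < c / 2"
    using \<open>strict_mono r\<close> by (rule eventually_subseq[rotated])
  then obtain k where k: "\<bar>\<nu> (r k) h\<bar> < c / 2"
    using eventually_happens'[OF sequentially_bot] by blast

  \<comment> \<open>Under \<open>P (r k)\<close> and \<open>Q (r k)\<close> the later functions are negligible, since they vanish near \<open>F (r k)\<close>,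
    and the earlier ones, collected in \<open>S\<close>, contribute little by the choice of \<open>r k\<close>.\<close>
  define S where "S x = (\<Sum>j<k. q (r j) x)" for x
  have Sh: "0 \<le> S x \<and> 0 \<le> h x - (S x + q (r k) x)" 
    and Sh_eq: "infdist x (F (r k)) < \<rho> \<Longrightarrow> h x = S x + q (r k) x" for x
  proof -
    have S: "S x + q (r k) x = (\<Sum>j\<le>k. q (r j) x)"
      by (simp add: S_def lessThan_Suc_atMost[symmetric])
    have "0 \<le> h x - (S x + q (r k) x) \<and> 
       (infdist x (F (r k)) < \<rho> \<longrightarrow> h x = S x + q (r k) x)"
    proof (cases "\<forall>j. q (r j) x = 0")
      case True
      then show ?thesis using h_le[of x 0] h0[of x] S by simp
    next
      case False
      then obtain i where i: "q (r i) x \<noteq> 0" by blast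
      have q_i: "q (r j) x = (if j = i then q (r i) x else 0)" for j
        using uniq[OF i] by simp
      have hi: "h x = q (r i) x"
        using h_ge[of i x] h_le[of x "q (r i) x"] q_i q0[of "r i" x] by (smt (verit))
      have "S x + q (r k) x = (if i \<le> k then q (r i) x else 0)"
        unfolding S by (subst q_i) simp
      moreover have "i \<le> k" if "infdist x (F (r k)) < \<rho>"
        using zero[OF _ that, of i] i by (meson not_less)
      ultimately show ?thesis using hi q0[of "r i" x] by auto
    qed
    then show "0 \<le> S x \<and> 0 \<le> h x - (S x + q (r k) x)"
      "infdist x (F (r k)) < \<rho> \<Longrightarrow> h x = S x + q (r k) x"
      using q0 by (auto simp: S_def sum_nonneg)
  qed
  have [measurable]: "q j \<in> borel_measurable borel" "p j \<in> borel_measurable borel"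
      "h \<in> borel_measurable borel" for j
    using q_lip lip h_lip by (auto intro: lipschitz_on_UNIV_borel)
  have S_meas [measurable]: "S \<in> borel_measurable borel" unfolding S_def by measurable
  have S1: "\<bar>S x\<bar> \<le> 1" for x using Sh[of x] h1[of x] q0[of "r k" x] by auto
  have "\<bar>\<nu> (r k) h - \<nu> (r k) (\<lambda>x. S x + q (r k) x)\<bar> \<le> 2 * \<delta>"
  proof (rule \<nu>_off)
    show "\<bar>h x\<bar> \<le> 1" "\<bar>S x + q (r k) x\<bar> \<le> 1" "\<bar>h x - (S x + q (r k) x)\<bar> \<le> 1" for x
      using Sh[of x] h1[of x] h0[of x] q0[of "r k" x] by auto
    show "h x = S x + q (r k) x" if "x \<notin> {x. \<rho> / 4 \<le> infdist x (F (r k))}" for x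
      using Sh_eq[of x] that \<open>0 < \<rho>\<close> by auto
  qed auto
  moreover have "\<nu> (r k) (\<lambda>x. S x + q (r k) x) = \<nu> (r k) S + \<nu> (r k) (q (r k))"
  proof -
    have "integrable R S" "integrable R (q (r k))" if "borel_prob R" for R
      using that S1 q0 q1 by (auto intro!: borel_prob_integrable[where C=1])
    with P Q show ?thesis by (simp add: \<nu>_def)
  qed
  moreover have "\<bar>\<nu> (r k) (q (r k)) - \<nu> (r k) (p (r k))\<bar> \<le> 2 * \<delta>"
  proof (rule \<nu>_off)
    show "\<bar>q (r k) x\<bar> \<le> 1" "\<bar>p (r k) x\<bar> \<le> 1" "\<bar>q (r k) x - p (r k) x\<bar> \<le> 1" for x
      using q0[of "r k" x] q1[of "r k" x] qp[of "r k" x] p1[of "r k" x] by auto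
  qed (use q_eq in auto)
  moreover have "\<bar>\<nu> (r k) S\<bar> < c / 8"
  proof -
    have "S = (\<lambda>x. \<Sum>i\<in>r ` {..<k}. q i x)"
      using strict_mono_imp_inj_on[OF \<open>strict_mono r\<close>]
      by (auto simp: S_def fun_eq_iff sum.reindex inj_on_subset)
    moreover have "r ` {..<k} \<subseteq> {..s k}" using rs by auto
    ultimately show ?thesis using Gr[of k] by (simp add: G_def)
  qed
  moreover have "c \<le> \<bar>\<nu> (r k) (p (r k))\<bar>" using Gr[of k] by (simp add: G_def)
  ultimately show False using k \<open>0 < c\<close> unfolding \<delta>_def by linarith
qed

lemma lipschitz_on_pointwise_limit:
  fixes f :: "nat \<Rightarrow> 'c::metric_space \<Rightarrow> real"
  assumes lip: "\<And>n. L-lipschitz_on UNIV (f n)" and lim: "\<And>x. (\<lambda>n. f n x) \<longlonglongrightarrow> F x"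
  shows "L-lipschitz_on UNIV F"
  unfolding lipschitz_on_UNIV_iff_real
proof (intro conjI allI)
  show "0 \<le> L" using lip lipschitz_on_nonneg by blast
  fix x y
  have "(\<lambda>n. \<bar>f n x - f n y\<bar>) \<longlonglongrightarrow> \<bar>F x - F y\<bar>"
    by (intro tendsto_intros lim)
  then show "\<bar>F x - F y\<bar> \<le> L * dist x y"
    by (rule LIMSEQ_le_const2) (use lip in \<open>auto simp: lipschitz_on_UNIV_iff_real\<close>)
qed

text \<open>For a pointwise convergent sequence, \<open>f n - F\<close> differs by at most \<open>\<tau>\<close> from
  \<open>max 0 (f n - F - \<tau>) - max 0 (F - f n - \<tau>)\<close>. By equicontinuity both parts eventually vanish on a ball of
  fixed radius around each point, so that the gliding hump argument applies to them.\<close>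

lemma lipschitz_close_pointwise_convergent:
  fixes P Q :: "nat \<Rightarrow> 'c::{metric_space, second_countable_topology} measure"
    and f :: "nat \<Rightarrow> 'c \<Rightarrow> real"
  assumes P: "\<And>n. borel_prob (P n)" and Q: "\<And>n. borel_prob (Q n)"
    and close: "lipschitz_close P Q"
    and lip: "\<And>n. L-lipschitz_on UNIV (f n)"
    and f0: "\<And>n x. 0 \<le> f n x" and f1: "\<And>n x. f n x \<le> 1"
    and lim: "\<And>x. (\<lambda>n. f n x) \<longlonglongrightarrow> F x"
  shows "(\<lambda>n. (\<integral>x. f n x \<partial>P n) - (\<integral>x. f n x \<partial>Q n)) \<longlonglongrightarrow> 0"
proof (rule LIMSEQ_I)
  fix e :: real assume "0 < e"
  define \<tau> where "\<tau> = e / 8"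
  have \<tau>: "0 < \<tau>" using \<open>0 < e\<close> by (simp add: \<tau>_def)
  define \<nu> where "\<nu> n f = (\<integral>x. f x \<partial>P n) - (\<integral>x. f x \<partial>Q n)" for n and f :: "'c \<Rightarrow> real"
  have F_lip: "L-lipschitz_on UNIV F" by (rule lipschitz_on_pointwise_limit[OF lip lim])
  have L: "0 \<le> L" using F_lip lipschitz_on_nonneg by blast
  have F0: "0 \<le> F x" and F1: "F x \<le> 1" for x
    using LIMSEQ_le_const[OF lim[of x], of 0] LIMSEQ_le_const2[OF lim[of x], of 1] f0 f1 by auto
  define p where "p \<sigma> n x = max 0 (\<sigma> * (f n x - F x) - \<tau>)" for \<sigma> :: real and n x
  have dif: "\<bar>(f n x - F x) - (f n y - F y)\<bar> \<le> 2 * L * dist x y" for n x y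
  proof -
    have "\<bar>f n x - f n y\<bar> \<le> L * dist x y" "\<bar>F x - F y\<bar> \<le> L * dist x y"
      using lip[of n] F_lip by (simp_all add: lipschitz_on_UNIV_iff_real)
    then show ?thesis by linarith
  qed
  have p_lip: "(2 * L)-lipschitz_on UNIV (p \<sigma> n)" if "\<sigma> = 1 \<or> \<sigma> = -1" for \<sigma> n
    unfolding lipschitz_on_UNIV_iff_real
  proof (intro conjI allI)
    show "\<bar>p \<sigma> n x - p \<sigma> n y\<bar> \<le> 2 * L * dist x y" for x y
      using dif[of n x y] that by (auto simp: p_def)
  qed (use L in simp)
  have p0: "0 \<le> p \<sigma> n x" for \<sigma> n x by (simp add: p_def)
  have p1: "p \<sigma> n x \<le> 1" if "\<sigma> = 1 \<or> \<sigma> = -1" for \<sigma> n x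
    using F0[of x] F1[of x] f0[of n x] f1[of n x] that \<tau> by (auto simp: p_def)
  define \<rho> where "\<rho> = \<tau> / (4 * (L + 1))"
  have \<rho>: "0 < \<rho>" using \<tau> L by (simp add: \<rho>_def)
  have L\<rho>: "2 * L * \<rho> \<le> \<tau> / 2"
  proof -
    have "2 * L * \<rho> = \<tau> / 2 * (L / (L + 1))" using L by (simp add: \<rho>_def field_simps)
    also have "\<dots> \<le> \<tau> / 2 * 1" using L \<tau> by (intro mult_left_mono) auto
    finally show ?thesis by simp
  qed
  have lim_p: "(\<lambda>n. \<nu> n (p \<sigma> n)) \<longlonglongrightarrow> 0" if "\<sigma> = 1 \<or> \<sigma> = -1" for \<sigma>
    unfolding \<nu>_def
  proof (rule gliding_hump[OF P Q close p_lip[OF that] p0 p1[OF that] \<rho>])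
    fix x
    have "\<forall>\<^sub>F n in sequentially. \<bar>f n x - F x\<bar> < \<tau> / 2"
      using tendstoD[OF lim[of x], of "\<tau> / 2"] \<tau> by (simp add: dist_real_def)
    then show "\<forall>\<^sub>F n in sequentially. \<forall>y. dist x y < \<rho> \<longrightarrow> p \<sigma> n y = 0"
    proof eventually_elim
      case (elim n)
      show ?case
      proof (intro allI impI)
        fix y assume "dist x y < \<rho>"
        then have "2 * L * dist x y \<le> 2 * L * \<rho>" using L by (intro mult_left_mono) auto
        with dif[of n x y] elim L\<rho> have "\<bar>f n y - F y\<bar> \<le> \<tau>" by linarith
        then show "p \<sigma> n y = 0" using that by (auto simp: p_def)
      qed
    qed
  qed
  have "\<forall>\<^sub>F n in sequentially. \<bar>\<nu> n (p 1 n)\<bar> < e / 8" "\<forall>\<^sub>F n in sequentially. \<bar>\<nu> n (p (-1) n)\<bar> < e / 8"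
    "\<forall>\<^sub>F n in sequentially. \<bar>\<nu> n F\<bar> < e / 8"
  proof -
    have "bounded (range F)" using F0 F1 by (intro boundedI[where B=1]) auto
    then have "(\<lambda>n. \<nu> n F) \<longlonglongrightarrow> 0" using F_lip close unfolding lipschitz_close_def \<nu>_def by blast
    with lim_p[of 1] lim_p[of "-1"] show "\<forall>\<^sub>F n in sequentially. \<bar>\<nu> n (p 1 n)\<bar> < e / 8"
      "\<forall>\<^sub>F n in sequentially. \<bar>\<nu> n (p (-1) n)\<bar> < e / 8" "\<forall>\<^sub>F n in sequentially. \<bar>\<nu> n F\<bar> < e / 8"
      using \<open>0 < e\<close> by (auto dest!: tendstoD[where e="e / 8"])
  qed
  then have "\<forall>\<^sub>F n in sequentially. norm (\<nu> n (f n) - 0) < e"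
  proof eventually_elim
    case (elim n)
    have [measurable]: "F \<in> borel_measurable borel" "f n \<in> borel_measurable borel"
      using F_lip lip by (auto intro: lipschitz_on_UNIV_borel)
    have [measurable]: "p \<sigma> n \<in> borel_measurable borel" for \<sigma>
      unfolding p_def by measurable
    have near: "\<bar>(\<integral>x. f n x \<partial>R) - ((\<integral>x. F x \<partial>R) + (\<integral>x. p 1 n x \<partial>R) - (\<integral>x. p (-1) n x \<partial>R))\<bar> \<le> \<tau>"
      if R: "borel_prob R" for R
    proof -
      have "integrable R F" "integrable R (p 1 n)" "integrable R (p (-1) n)"
        using R F0 F1 p0 p1 by (auto intro!: borel_prob_integrable[where C=1])
      then have "(\<integral>x. F x \<partial>R) + (\<integral>x. p 1 n x \<partial>R) - (\<integral>x. p (-1) n x \<partial>R)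
          = (\<integral>x. F x + p 1 n x - p (-1) n x \<partial>R)" by simp
      moreover have "\<bar>(\<integral>x. f n x \<partial>R) - (\<integral>x. F x + p 1 n x - p (-1) n x \<partial>R)\<bar> \<le> \<tau>"
      proof (rule borel_prob_integral_near[OF R, where C=3])
        fix x
        show "\<bar>f n x\<bar> \<le> 3" using f0[of n x] f1[of n x] by simp
        show "\<bar>F x + p 1 n x - p (-1) n x\<bar> \<le> 3"
          using F0[of x] F1[of x] p0[of 1 n x] p1[of 1 n x] p0[of "-1" n x] p1[of "-1" n x] by simp
        show "\<bar>f n x - (F x + p 1 n x - p (-1) n x)\<bar> \<le> \<tau>"
          using \<tau> by (simp add: p_def)
      qed auto
      ultimately show ?thesis by simp
    qed
    from near[OF P[of n]] near[OF Q[of n]] elim show ?case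
      using \<open>0 < e\<close> unfolding \<nu>_def \<tau>_def real_norm_def by linarith
  qed
  then show "\<exists>N. \<forall>n\<ge>N. norm ((\<integral>x. f n x \<partial>P n) - (\<integral>x. f n x \<partial>Q n) - 0) < e"
    by (simp add: \<nu>_def eventually_sequentially)
qed

lemma lipschitz_close_subseq:
  assumes "lipschitz_close P Q" "strict_mono r"
  shows "lipschitz_close (P \<circ> r) (Q \<circ> r)"
  unfolding lipschitz_close_def
proof (intro allI impI)
  fix h :: "'a \<Rightarrow> real" and L
  assume "L-lipschitz_on UNIV h \<and> bounded (range h)"
  then have "(\<lambda>n. (\<integral>x. h x \<partial>P n) - (\<integral>x. h x \<partial>Q n)) \<longlonglongrightarrow> 0"
    using assms(1) unfolding lipschitz_close_def by blast
  from LIMSEQ_subseq_LIMSEQ[OF this assms(2)]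
  show "(\<lambda>n. (\<integral>x. h x \<partial>(P \<circ> r) n) - (\<integral>x. h x \<partial>(Q \<circ> r) n)) \<longlonglongrightarrow> 0"
    by (simp add: o_def)
qed

text \<open>A form of the Arzela-Ascoli theorem for pointwise convergence, without compactness of the domain:
  a diagonal subsequence converges on a countable dense set, and equicontinuity extends this to all points.\<close>

lemma lipschitz_on_convergent_subsequence:
  fixes f :: "nat \<Rightarrow> 'c::{metric_space, second_countable_topology} \<Rightarrow> real"
  assumes lip: "\<And>n. L-lipschitz_on UNIV (f n)" and bd: "\<And>n x. \<bar>f n x\<bar> \<le> C"
  obtains k F where "strict_mono (k :: nat \<Rightarrow> nat)" "\<And>x. (\<lambda>n. f (k n) x) \<longlonglongrightarrow> F x"
proof -
  obtain D :: "'c set" where D: "countable D" "\<And>U. open U \<Longrightarrow> U \<noteq> {} \<Longrightarrow> \<exists>d\<in>D. d \<in> U"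
    using countable_dense_setE by metis
  obtain k where k: "strict_mono k" "\<And>d. d \<in> D \<Longrightarrow> \<exists>l. (\<lambda>n. f (k n) d) \<longlonglongrightarrow> l"
    using function_convergent_subsequence[OF D(1), of f C] bd by auto
  have L: "0 \<le> L" using lip lipschitz_on_nonneg by blast
  have "convergent (\<lambda>n. f (k n) x)" for x
  proof (rule Cauchy_convergent, rule metric_CauchyI)
    fix e :: real assume "0 < e"
    define \<eta> where "\<eta> = e / (4 * (L + 1))"
    have \<eta>: "0 < \<eta>" using \<open>0 < e\<close> L by (simp add: \<eta>_def)
    obtain d where d: "d \<in> D" "dist x d < \<eta>"
      using D(2)[of "ball x \<eta>"] \<eta> by auto
    have "L * dist x d \<le> L * \<eta>" using d L by (intro mult_left_mono) auto
    also have "\<dots> = e / 4 * (L / (L + 1))" using L by (simp add: \<eta>_def field_simps)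
    also have "\<dots> \<le> e / 4 * 1" using L \<open>0 < e\<close> by (intro mult_left_mono) auto
    finally have "L * dist x d \<le> e / 4" by simp
    moreover have "\<bar>f n x - f n d\<bar> \<le> L * dist x d" for n
      using lip[of n] by (simp add: lipschitz_on_UNIV_iff_real)
    ultimately have near: "\<bar>f n x - f n d\<bar> \<le> e / 4" for n
      by (meson order_trans)
    have "Cauchy (\<lambda>n. f (k n) d)" using k(2)[OF d(1)] by (auto intro: LIMSEQ_imp_Cauchy)
    then obtain N where N: "\<And>m n. N \<le> m \<Longrightarrow> N \<le> n \<Longrightarrow> dist (f (k m) d) (f (k n) d) < e / 4"
      using \<open>0 < e\<close> unfolding Cauchy_def by (metis divide_pos_pos zero_less_numeral)
    show "\<exists>N. \<forall>m\<ge>N. \<forall>n\<ge>N. dist (f (k m) x) (f (k n) x) < e"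
    proof (intro exI allI impI)
      fix m n assume "N \<le> m" "N \<le> n"
      from N[OF this] near[of "k m"] near[of "k n"] \<open>0 < e\<close>
      show "dist (f (k m) x) (f (k n) x) < e" unfolding dist_real_def by linarith
    qed
  qed
  then have "(\<lambda>n. f (k n) x) \<longlonglongrightarrow> lim (\<lambda>n. f (k n) x)" for x
    by (simp add: convergent_LIMSEQ_iff)
  with k(1) show ?thesis by (rule that)
qed

text \<open>Closeness for each fixed bounded Lipschitz function is automatically uniform over all \<open>L\<close>-Lipschitz
  functions with values in \<open>[0, 1]\<close>: the test function may vary with \<open>n\<close>.\<close>

proposition lipschitz_close_uniform:
  fixes P Q :: "nat \<Rightarrow> 'c::{metric_space, second_countable_topology} measure"
    and f :: "nat \<Rightarrow> 'c \<Rightarrow> real"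
  assumes P: "\<And>n. borel_prob (P n)" and Q: "\<And>n. borel_prob (Q n)"
    and close: "lipschitz_close P Q"
    and lip: "\<And>n. L-lipschitz_on UNIV (f n)"
    and f0: "\<And>n x. 0 \<le> f n x" and f1: "\<And>n x. f n x \<le> 1"
  shows "(\<lambda>n. (\<integral>x. f n x \<partial>P n) - (\<integral>x. f n x \<partial>Q n)) \<longlonglongrightarrow> 0"
proof (rule ccontr)
  assume "\<not> ?thesis"
  then obtain c where "0 < c"
    and c: "\<not> (\<forall>\<^sub>F n in sequentially. \<bar>(\<integral>x. f n x \<partial>P n) - (\<integral>x. f n x \<partial>Q n)\<bar> < c)"
    unfolding tendsto_iff by auto
  obtain r :: "nat \<Rightarrow> nat" where r: "strict_mono r"
    "\<And>n. \<not> \<bar>(\<integral>x. f (r n) x \<partial>P (r n)) - (\<integral>x. f (r n) x \<partial>Q (r n))\<bar> < c"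
    using not_eventually_sequentiallyD[OF c] by blast
  obtain k F where k: "strict_mono (k :: nat \<Rightarrow> nat)" "\<And>x. (\<lambda>n. f (r (k n)) x) \<longlonglongrightarrow> F x"
    using lipschitz_on_convergent_subsequence[of L "\<lambda>n. f (r n)" 1] lip f0 f1 by auto
  have rk: "strict_mono (r \<circ> k)" using r(1) k(1) by (rule strict_mono_o)
  have "(\<lambda>n. (\<integral>x. f (r (k n)) x \<partial>(P \<circ> (r \<circ> k)) n) - (\<integral>x. f (r (k n)) x \<partial>(Q \<circ> (r \<circ> k)) n)) \<longlonglongrightarrow> 0"
    by (rule lipschitz_close_pointwise_convergent[OF _ _ lipschitz_close_subseq[OF close rk] lip f0 f1 k(2)])
      (simp_all add: P Q)
  from tendstoD[OF this \<open>0 < c\<close>] r(2) show False by simp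
qed

section \<open>The Levy-Prokhorov distance and Lipschitz functions\<close>

lemma metric_nbhd_iff:
  "y \<in> metric_nbhd m A \<epsilon> \<longleftrightarrow> (\<exists>x\<in>A. x \<in> mspace m \<and> y \<in> mspace m \<and> mdist m x y < \<epsilon>)"
  by (auto simp: metric_nbhd_def)

text \<open>The infimum that defines the Levy-Prokhorov distance is taken over a nonempty set, because \<open>1\<close> is
  always admissible. Without this the infimum would be an unspecified number.\<close>

lemma levy_prokhorov_set_one:
  assumes "prob_space \<mu>"
  shows "(1::real) \<in> {\<epsilon>. 0 < \<epsilon> \<and> (\<forall>A. closedin (mtopology_of m) A \<longrightarrow>
        measure \<mu> A \<le> measure \<nu> (metric_nbhd m A \<epsilon>) + \<epsilon>)}"
  using prob_space.prob_le_1[OF assms] by (auto intro: add_increasing)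

lemma levy_prokhorov_nonneg:
  assumes "prob_space \<mu>"
  shows "0 \<le> levy_prokhorov m \<mu> \<nu>"
  unfolding levy_prokhorov_def
proof (rule cInf_greatest)
  show "{\<epsilon>. 0 < \<epsilon> \<and> (\<forall>A. closedin (mtopology_of m) A \<longrightarrow>
      measure \<mu> A \<le> measure \<nu> (metric_nbhd m A \<epsilon>) + \<epsilon>)} \<noteq> {}"
    using levy_prokhorov_set_one[OF assms, of m \<nu>] by (rule ex_in_conv[THEN iffD1, OF exI])
qed simp

lemma levy_prokhorov_le:
  assumes "0 < \<epsilon>"
    and "\<And>A. closedin (mtopology_of m) A \<Longrightarrow> measure \<mu> A \<le> measure \<nu> (metric_nbhd m A \<epsilon>) + \<epsilon>"
  shows "levy_prokhorov m \<mu> \<nu> \<le> \<epsilon>"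
  unfolding levy_prokhorov_def using assms by (intro cInf_lower bdd_belowI[of _ 0]) auto

lemma levy_prokhorov_less_obtain:
  assumes "prob_space \<mu>" "levy_prokhorov m \<mu> \<nu> < \<delta>"
  obtains \<epsilon> where "0 < \<epsilon>" "\<epsilon> < \<delta>"
    "\<And>A. closedin (mtopology_of m) A \<Longrightarrow> measure \<mu> A \<le> measure \<nu> (metric_nbhd m A \<epsilon>) + \<epsilon>"
  using cInf_lessD[OF _ assms(2)[unfolded levy_prokhorov_def]] levy_prokhorov_set_one[OF assms(1), of m \<nu>]
  by blast

text \<open>A closed set \<open>A\<close> that violates the Levy-Prokhorov inequality for \<open>\<epsilon>\<close> yields the Lipschitz function
  \<open>max 0 (1 - 2 / \<epsilon> * infdist z A)\<close>, squeezed between the indicators of \<open>A\<close> and of its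
  \<open>\<epsilon>\<close>-neighbourhood, whose two integrals differ by more than \<open>\<epsilon>\<close>.\<close>

lemma levy_prokhorov_tendsto_0:
  fixes P Q :: "nat \<Rightarrow> ('a::{metric_space, second_countable_topology} \<times> 'b::{metric_space, second_countable_topology}) measure"
  assumes P: "\<And>n. borel_prob (P n)" and Q: "\<And>n. borel_prob (Q n)"
    and close: "lipschitz_close P Q"
  shows "(\<lambda>n. levy_prokhorov sum_metric (P n) (Q n)) \<longlonglongrightarrow> 0"
proof (rule LIMSEQ_I)
  fix e :: real assume "0 < e"
  define \<epsilon> where "\<epsilon> = e / 2"
  have \<epsilon>: "0 < \<epsilon>" using \<open>0 < e\<close> by (simp add: \<epsilon>_def)
  define bad where "bad n A \<longleftrightarrow> closed A \<and> measure (Q n) (metric_nbhd sum_metric A \<epsilon>) + \<epsilon> < measure (P n) A"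
    for n and A :: "('a \<times> 'b) set"
  define A where "A n = (SOME A. bad n A)" for n
  define f where "f n z = (if bad n (A n) then max 0 (1 - 2 / \<epsilon> * infdist z (A n)) else 0)" for n z
  have f0: "0 \<le> f n z" and f1: "f n z \<le> 1" for n z
    using infdist_nonneg[of z "A n"] \<epsilon> by (auto simp: f_def)
  have lip: "(2 / \<epsilon>)-lipschitz_on UNIV (f n)" for n
    unfolding lipschitz_on_UNIV_iff_real
  proof (intro conjI allI)
    fix x y
    have "\<bar>2 / \<epsilon> * infdist x (A n) - 2 / \<epsilon> * infdist y (A n)\<bar> \<le> 2 / \<epsilon> * dist x y"
      using \<epsilon> by (intro scaled_infdist_diff_le) simp
    then show "\<bar>f n x - f n y\<bar> \<le> 2 / \<epsilon> * dist x y"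
      using \<epsilon> by (auto simp: f_def)
  qed (use \<epsilon> in simp)
  have "(\<lambda>n. (\<integral>z. f n z \<partial>P n) - (\<integral>z. f n z \<partial>Q n)) \<longlonglongrightarrow> 0"
    by (rule lipschitz_close_uniform[OF P Q close lip f0 f1])
  from tendstoD[OF this \<epsilon>]
  have "\<forall>\<^sub>F n in sequentially. \<bar>(\<integral>z. f n z \<partial>P n) - (\<integral>z. f n z \<partial>Q n)\<bar> < \<epsilon>"
    by (simp add: dist_real_def)
  then have "\<forall>\<^sub>F n in sequentially. norm (levy_prokhorov sum_metric (P n) (Q n) - 0) < e"
  proof eventually_elim
    case (elim n)
    interpret P: prob_space "P n" using P[of n] by (simp add: borel_prob_def)
    interpret Q: prob_space "Q n" using Q[of n] by (simp add: borel_prob_def)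
    have sets: "sets (P n) = sets borel" "sets (Q n) = sets borel" "space (P n) = UNIV" "space (Q n) = UNIV"
      using P[of n] Q[of n] by (auto simp: borel_prob_def dest: sets_eq_imp_space_eq)
    have f_meas: "f n \<in> borel_measurable borel" by (rule lipschitz_on_UNIV_borel[OF lip])
    have int: "integrable (P n) (f n)" "integrable (Q n) (f n)"
      using P Q f_meas f0 f1 by (auto intro!: borel_prob_integrable[where C=1])
    have "\<not> bad n B" for B
    proof
      assume "bad n B"
      then have b: "bad n (A n)" unfolding A_def by (rule someI)
      then have cl: "closed (A n)" by (simp add: bad_def)
      have ne: "A n \<noteq> {}"
      proof
        assume "A n = {}"
        with b have "measure (Q n) (metric_nbhd sum_metric {} \<epsilon>) + \<epsilon> < 0" by (simp add: bad_def)
        then show False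
          using \<epsilon> measure_nonneg[of "Q n" "metric_nbhd sum_metric {} \<epsilon>"] by linarith
      qed
      have nb: "metric_nbhd sum_metric (A n) \<epsilon> \<in> sets borel"
      proof -
        have "metric_nbhd sum_metric (A n) \<epsilon> = (\<Union>a\<in>A n. {z. dist (fst a) (fst z) + dist (snd a) (snd z) < \<epsilon>})"
          by (simp add: set_eq_iff metric_nbhd_iff del: split_paired_All)
        moreover have "open {z :: 'a \<times> 'b. dist (fst a) (fst z) + dist (snd a) (snd z) < \<epsilon>}" for a
          by (intro open_Collect_less continuous_intros)
        ultimately show ?thesis by (simp only:) (intro borel_open open_UN ballI)
      qed
      have "measure (P n) (A n) = (\<integral>z. indicator (A n) z \<partial>P n)" by (simp add: sets)
      also have "\<dots> \<le> (\<integral>z. f n z \<partial>P n)"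
      proof (intro integral_mono)
        show "indicator (A n) z \<le> f n z" for z
          using b f0[of n z] by (cases "z \<in> A n") (simp_all add: f_def)
      qed (use int cl in \<open>auto simp: sets P.emeasure_eq_measure\<close>)
      also have "\<dots> < (\<integral>z. f n z \<partial>Q n) + \<epsilon>" using elim by linarith
      also have "(\<integral>z. f n z \<partial>Q n) \<le> (\<integral>z. indicator (metric_nbhd sum_metric (A n) \<epsilon>) z \<partial>Q n)"
      proof (intro integral_mono)
        fix z
        show "f n z \<le> indicator (metric_nbhd sum_metric (A n) \<epsilon>) z"
        proof (cases "z \<in> metric_nbhd sum_metric (A n) \<epsilon>")
          case False
          \<comment> \<open>The Euclidean distance on the product is at least half of the sum metric, whence the factor \<open>2\<close>.\<close>
          have "\<epsilon> / 2 \<le> infdist z (A n)"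
          proof (rule ccontr)
            assume "\<not> \<epsilon> / 2 \<le> infdist z (A n)"
            then obtain a where a: "a \<in> A n" "dist z a < \<epsilon> / 2"
              using infdist_less_obtain[OF _ ne, of z "\<epsilon> / 2"] by (auto simp: not_le)
            then have "mdist sum_metric a z < \<epsilon>"
              using dist_fst_le[of a z] dist_snd_le[of a z] by (simp add: dist_commute)
            with a False show False by (auto simp: metric_nbhd_iff)
          qed
          then have "1 - 2 / \<epsilon> * infdist z (A n) \<le> 0" using \<epsilon> by (simp add: field_simps)
          with False show ?thesis by (simp add: f_def)
        qed (simp add: f1)
      qed (use int nb in \<open>auto simp: sets Q.emeasure_eq_measure\<close>)
      also have "\<dots> = measure (Q n) (metric_nbhd sum_metric (A n) \<epsilon>)" by (simp add: sets)
      finally show False using b by (simp add: bad_def)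
    qed
    then have "levy_prokhorov sum_metric (P n) (Q n) \<le> \<epsilon>"
      using \<epsilon> by (intro levy_prokhorov_le) (auto simp: bad_def not_less)
    moreover have "0 \<le> levy_prokhorov sum_metric (P n) (Q n)"
      by (rule levy_prokhorov_nonneg) unfold_locales
    ultimately show ?case using \<open>0 < e\<close> by (simp add: \<epsilon>_def)
  qed
  then show "\<exists>N. \<forall>n\<ge>N. norm (levy_prokhorov sum_metric (P n) (Q n) - 0) < e"
    by (simp add: eventually_sequentially)
qed

section \<open>Integrals of functions with a given modulus of continuity\<close>

text \<open>The number of levels \<open>1, \<dots>, N\<close> that are at most \<open>u\<close> approximates \<open>u\<close> up to \<open>1\<close>
  if \<open>0 \<le> u \<le> N\<close>. Summing
  indicators of level sets thus gives a discrete version of the layer-cake formula.\<close>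

lemma card_levels_le:
  assumes "0 \<le> u"
  shows "real (card {i\<in>{1..N}. real i \<le> u}) \<le> u"
proof -
  have "card {i\<in>{1..N}. real i \<le> u} \<le> card {1..nat \<lfloor>u\<rfloor>}"
    by (intro card_mono) (auto simp: le_nat_floor)
  also have "real \<dots> \<le> u" using assms by simp
  finally show ?thesis by simp
qed

lemma card_levels_ge:
  assumes "u \<le> real N"
  shows "u \<le> 1 + real (card {i\<in>{1..N}. real i \<le> u})"
proof (cases "0 \<le> u")
  case True
  have "card {1..nat \<lfloor>u\<rfloor>} \<le> card {i\<in>{1..N}. real i \<le> u}"
  proof (intro card_mono subsetI)
    fix i assume "i \<in> {1..nat \<lfloor>u\<rfloor>}"
    then have "1 \<le> i" "i \<le> nat \<lfloor>u\<rfloor>" by simp_all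
    moreover from this(2) have "real i \<le> u" using True by linarith
    moreover from this assms have "real i \<le> real N" by linarith
    ultimately show "i \<in> {i\<in>{1..N}. real i \<le> u}" by simp
  qed simp
  then have "real (nat \<lfloor>u\<rfloor>) \<le> real (card {i\<in>{1..N}. real i \<le> u})" by simp
  then show ?thesis using True by linarith
qed simp

text \<open>The level set \<open>{h \<ge> i / N}\<close> is closed, and its \<open>\<epsilon>\<close>-neighbourhood lies in \<open>{h + \<omega> \<ge> i / N}\<close>.
  Averaging the hypothesis over \<open>i\<close> compares the integrals; \<open>N > 1 / \<epsilon>\<close> makes the discretization
  error smaller than \<open>\<epsilon>\<close>.\<close>

lemma integral_le_of_nbhd_le:
  fixes h :: "'c::metric_space \<Rightarrow> real"
  assumes \<mu>: "borel_prob \<mu>" and \<nu>: "borel_prob \<nu>" and "0 < \<epsilon>" and m: "mspace m = UNIV"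
    and nbhd: "\<And>A. closed A \<Longrightarrow> measure \<mu> A \<le> measure \<nu> (metric_nbhd m A \<epsilon>) + \<epsilon>"
    and h: "continuous_on UNIV h" and h0: "\<And>x. 0 \<le> h x" and h1: "\<And>x. h x \<le> 1"
    and modulus: "\<And>x y. mdist m x y < \<epsilon> \<Longrightarrow> h x \<le> h y + \<omega>"
  shows "(\<integral>x. h x \<partial>\<mu>) \<le> (\<integral>x. h x \<partial>\<nu>) + \<omega> + 2 * \<epsilon>"
proof -
  interpret \<mu>: prob_space \<mu> using \<mu> by (simp add: borel_prob_def)
  interpret \<nu>: prob_space \<nu> using \<nu> by (simp add: borel_prob_def)
  have sets: "sets \<mu> = sets borel" "sets \<nu> = sets borel" "space \<mu> = UNIV" "space \<nu> = UNIV"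
    using \<mu> \<nu> by (auto simp: borel_prob_def dest: sets_eq_imp_space_eq)
  have "0 \<le> \<omega>"
  proof -
    fix x :: 'c
    have "mdist m x x = 0" using m by (intro Metric_space.mdist_zero[OF Metric_space_mspace_mdist]) auto
    then have "h x \<le> h x + \<omega>" using \<open>0 < \<epsilon>\<close> by (intro modulus) simp
    then show ?thesis by simp
  qed
  have hm: "h \<in> borel_measurable borel" using h by (rule borel_measurable_continuous_onI)
  have int: "integrable \<mu> h" "integrable \<nu> h"
    using \<mu> \<nu> hm h0 h1 by (auto intro!: borel_prob_integrable[where C=1])
  obtain N where N: "1 / \<epsilon> < real N" using reals_Archimedean2 by blast
  have N0: "0 < real N" using N \<open>0 < \<epsilon>\<close> by (meson divide_pos_pos less_trans zero_less_one)
  define A where "A i = {x. real i \<le> N * h x}" for i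
  define B where "B i = {x. real i \<le> N * (h x + \<omega>)}" for i
  have A_closed: "closed (A i)" for i unfolding A_def
    by (intro closed_Collect_le continuous_intros h)
  have B_closed: "closed (B i)" for i unfolding B_def
    by (intro closed_Collect_le continuous_intros h)
  have AB: "measure \<mu> (A i) \<le> measure \<nu> (B i) + \<epsilon>" for i
  proof -
    have "metric_nbhd m (A i) \<epsilon> \<subseteq> B i"
    proof
      fix y assume "y \<in> metric_nbhd m (A i) \<epsilon>"
      then obtain x where "x \<in> A i" "mdist m x y < \<epsilon>" by (auto simp: metric_nbhd_iff)
      then have "real i \<le> N * h x" "N * h x \<le> N * (h y + \<omega>)"
        using modulus N0 by (auto simp: A_def)
      then show "y \<in> B i" by (simp add: B_def)
    qed
    then have "measure \<nu> (metric_nbhd m (A i) \<epsilon>) \<le> measure \<nu> (B i)"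
      using B_closed by (intro \<nu>.finite_measure_mono) (auto simp: sets)
    with nbhd[OF A_closed, of i] show ?thesis by linarith
  qed
  have count: "(\<Sum>i=1..N. indicator {x. real i \<le> g x} x) = real (card {i\<in>{1..N}. real i \<le> g x})"
    for g :: "'c \<Rightarrow> real" and x
    by (simp add: indicator_def sum.If_cases Int_def)
  have level_int: "integrable \<mu> (\<lambda>x. indicator (A i) x :: real)" "integrable \<nu> (\<lambda>x. indicator (B i) x :: real)" for i
    using A_closed B_closed by (auto simp: sets \<mu>.emeasure_eq_measure \<nu>.emeasure_eq_measure)
  have "N * (\<integral>x. h x \<partial>\<mu>) = (\<integral>x. N * h x \<partial>\<mu>)" by simp
  also have "\<dots> \<le> (\<integral>x. 1 + (\<Sum>i=1..N. indicator (A i) x) \<partial>\<mu>)"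
  proof (intro integral_mono)
    fix x
    have "real N * h x \<le> real N * 1" using h1 N0 by (intro mult_left_mono) auto
    then show "N * h x \<le> 1 + (\<Sum>i=1..N. indicator (A i) x)"
      using card_levels_ge[of "N * h x" N] unfolding A_def count[of "\<lambda>x. N * h x"] by simp
  qed (use int level_int in auto)
  also have "\<dots> = 1 + (\<Sum>i=1..N. measure \<mu> (A i))"
    using level_int A_closed \<mu>.prob_space by (simp add: sets)
  also have "\<dots> \<le> 1 + (\<Sum>i=1..N. measure \<nu> (B i) + \<epsilon>)" using AB by (intro add_mono sum_mono) auto
  also have "\<dots> = 1 + N * \<epsilon> + (\<integral>x. (\<Sum>i=1..N. indicator (B i) x) \<partial>\<nu>)"
    using level_int B_closed by (simp add: sets sum.distrib)
  also have "(\<integral>x. (\<Sum>i=1..N. indicator (B i) x) \<partial>\<nu>) \<le> (\<integral>x. N * (h x + \<omega>) \<partial>\<nu>)"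
  proof (intro integral_mono)
    fix x
    have "0 \<le> N * (h x + \<omega>)" using N0 h0 \<open>0 \<le> \<omega>\<close> by simp
    then show "(\<Sum>i=1..N. indicator (B i) x) \<le> N * (h x + \<omega>)"
      using card_levels_le[of "N * (h x + \<omega>)" N] unfolding B_def count[of "\<lambda>x. N * (h x + \<omega>)"] by simp
  qed (use int level_int in auto)
  also have "\<dots> = N * ((\<integral>x. h x \<partial>\<nu>) + \<omega>)" using int by (simp add: \<nu>.prob_space)
  finally have "N * (\<integral>x. h x \<partial>\<mu>) \<le> 1 + N * \<epsilon> + N * ((\<integral>x. h x \<partial>\<nu>) + \<omega>)" by simp
  moreover have "1 < N * \<epsilon>" using N \<open>0 < \<epsilon>\<close> by (simp add: field_simps)
  ultimately have "N * (\<integral>x. h x \<partial>\<mu>) \<le> N * ((\<integral>x. h x \<partial>\<nu>) + \<omega> + 2 * \<epsilon>)"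
    by (simp add: algebra_simps)
  then show ?thesis using N0 by simp
qed

text \<open>Applying the one-sided bound to affine rescalings of \<open>h\<close> and \<open>-h\<close> gives a two-sided one,
  although the hypothesis is not symmetric in \<open>\<mu>\<close> and \<open>\<nu>\<close>.\<close>

lemma integral_near_of_nbhd_le:
  fixes h :: "'c::metric_space \<Rightarrow> real"
  assumes \<mu>: "borel_prob \<mu>" and \<nu>: "borel_prob \<nu>" and "0 < \<epsilon>" and m: "mspace m = UNIV"
    and nbhd: "\<And>A. closed A \<Longrightarrow> measure \<mu> A \<le> measure \<nu> (metric_nbhd m A \<epsilon>) + \<epsilon>"
    and h: "continuous_on UNIV h" and C: "0 < C" and hC: "\<And>x. \<bar>h x\<bar> \<le> C"
    and modulus: "\<And>x y. mdist m x y < \<epsilon> \<Longrightarrow> \<bar>h x - h y\<bar> \<le> \<omega>"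
  shows "\<bar>(\<integral>x. h x \<partial>\<mu>) - (\<integral>x. h x \<partial>\<nu>)\<bar> \<le> \<omega> + 4 * C * \<epsilon>"
proof -
  have one_sided: "\<sigma> * (\<integral>x. h x \<partial>\<mu>) \<le> \<sigma> * (\<integral>x. h x \<partial>\<nu>) + \<omega> + 4 * C * \<epsilon>" if \<sigma>: "\<sigma> = 1 \<or> \<sigma> = -1" for \<sigma> :: real
  proof -
    define g where "g x = (\<sigma> * h x + C) / (2 * C)" for x
    have "(\<integral>x. g x \<partial>\<mu>) \<le> (\<integral>x. g x \<partial>\<nu>) + \<omega> / (2 * C) + 2 * \<epsilon>"
    proof (rule integral_le_of_nbhd_le[OF \<mu> \<nu> \<open>0 < \<epsilon>\<close> m nbhd])
      show "continuous_on UNIV g" unfolding g_def using C by (intro continuous_intros h) auto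
      show "0 \<le> g x" "g x \<le> 1" for x
        using \<sigma> C hC[of x] by (auto simp: g_def field_simps abs_le_iff)
      show "g x \<le> g y + \<omega> / (2 * C)" if "mdist m x y < \<epsilon>" for x y
      proof -
        have "g y + \<omega> / (2 * C) - g x = (\<omega> - \<sigma> * (h x - h y)) / (2 * C)"
          by (simp add: g_def diff_divide_distrib[symmetric] add_divide_distrib[symmetric] algebra_simps)
        also have "\<dots> \<ge> 0" using modulus[OF that] \<sigma> C by (auto simp: abs_le_iff)
        finally show ?thesis by simp
      qed
    qed
    moreover have "(\<integral>x. g x \<partial>R) = (\<sigma> * (\<integral>x. h x \<partial>R) + C) / (2 * C)" if R: "borel_prob R" for R
    proof -
      interpret prob_space R using R by (simp add: borel_prob_def)
      have "integrable R h"
        using borel_prob_integrable[OF R borel_measurable_continuous_onI[OF h] hC] .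
      then show ?thesis by (simp add: g_def prob_space)
    qed
    ultimately have "(\<sigma> * (\<integral>x. h x \<partial>\<mu>) + C) / (2 * C) \<le> (\<sigma> * (\<integral>x. h x \<partial>\<nu>) + C) / (2 * C) + \<omega> / (2 * C) + 2 * \<epsilon>"
      using \<mu> \<nu> by simp
    then have "2 * C * ((\<sigma> * (\<integral>x. h x \<partial>\<mu>) + C) / (2 * C)) \<le>
        2 * C * ((\<sigma> * (\<integral>x. h x \<partial>\<nu>) + C) / (2 * C) + \<omega> / (2 * C) + 2 * \<epsilon>)"
      using C by (intro mult_left_mono) auto
    moreover have "2 * C * (u / (2 * C)) = u" for u using C by simp
    ultimately have "\<sigma> * (\<integral>x. h x \<partial>\<mu>) + C \<le> \<sigma> * (\<integral>x. h x \<partial>\<nu>) + C + \<omega> + 2 * C * (2 * \<epsilon>)"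
      by (simp only: distrib_left)
    then show ?thesis by simp
  qed
  from one_sided[of 1] one_sided[of "-1"] show ?thesis by linarith
qed

section \<open>Product laws\<close>

lemma borel_prob_pair:
  fixes \<alpha> :: "'a::second_countable_topology measure" and \<beta> :: "'b::second_countable_topology measure"
  assumes "borel_prob \<alpha>" "borel_prob \<beta>"
  shows "borel_prob (\<alpha> \<Otimes>\<^sub>M \<beta>)"
  using assms by (simp add: borel_prob_def prob_space_pair borel_prod[symmetric] cong: sets_pair_measure_cong)

lemma borel_prob_distr:
  assumes "prob_space M" "X \<in> M \<rightarrow>\<^sub>M borel"
  shows "borel_prob (distr M borel X)"
  using assms by (simp add: borel_prob_def prob_space.prob_space_distr)

lemma integral_pair_fst_near:
  fixes h :: "'a::{second_countable_topology} \<times> 'b::{second_countable_topology} \<Rightarrow> real"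
  assumes \<alpha>: "borel_prob \<alpha>" and \<alpha>': "borel_prob \<alpha>'" and \<beta>: "borel_prob \<beta>"
    and h: "h \<in> borel_measurable borel" "\<And>z. \<bar>h z\<bar> \<le> C"
    and near: "\<And>y. \<bar>(\<integral>x. h (x, y) \<partial>\<alpha>) - (\<integral>x. h (x, y) \<partial>\<alpha>')\<bar> \<le> \<eta>"
  shows "\<bar>(\<integral>z. h z \<partial>(\<alpha> \<Otimes>\<^sub>M \<beta>)) - (\<integral>z. h z \<partial>(\<alpha>' \<Otimes>\<^sub>M \<beta>))\<bar> \<le> \<eta>"
proof -
  interpret \<alpha>: prob_space \<alpha> using \<alpha> by (simp add: borel_prob_def)
  interpret \<alpha>': prob_space \<alpha>' using \<alpha>' by (simp add: borel_prob_def)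
  interpret \<beta>: prob_space \<beta> using \<beta> by (simp add: borel_prob_def)
  interpret S: pair_sigma_finite \<alpha> \<beta> ..
  interpret S': pair_sigma_finite \<alpha>' \<beta> ..
  have i: "integrable (\<alpha> \<Otimes>\<^sub>M \<beta>) (\<lambda>(x, y). h (x, y))" "integrable (\<alpha>' \<Otimes>\<^sub>M \<beta>) (\<lambda>(x, y). h (x, y))"
    using borel_prob_integrable[OF borel_prob_pair[OF \<alpha> \<beta>] h] borel_prob_integrable[OF borel_prob_pair[OF \<alpha>' \<beta>] h]
    by simp_all
  note I = S.integrable_snd[OF i(1)] S'.integrable_snd[OF i(2)]
  have "(\<integral>z. h z \<partial>(\<alpha> \<Otimes>\<^sub>M \<beta>)) - (\<integral>z. h z \<partial>(\<alpha>' \<Otimes>\<^sub>M \<beta>))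
      = (\<integral>y. (\<integral>x. h (x, y) \<partial>\<alpha>) - (\<integral>x. h (x, y) \<partial>\<alpha>') \<partial>\<beta>)"
    using S.integral_snd[OF i(1)] S'.integral_snd[OF i(2)] I by simp
  moreover have "\<dots> \<le> \<eta>"
    using I near by (intro \<beta>.integral_le_const) (auto simp: abs_le_iff)
  moreover have "-\<eta> \<le> (\<integral>y. (\<integral>x. h (x, y) \<partial>\<alpha>) - (\<integral>x. h (x, y) \<partial>\<alpha>') \<partial>\<beta>)"
  proof -
    have "-\<eta> \<le> (\<integral>x. h (x, y) \<partial>\<alpha>) - (\<integral>x. h (x, y) \<partial>\<alpha>')" for y using near[of y] by linarith
    then show ?thesis using I by (intro \<beta>.integral_ge_const) auto
  qed
  ultimately show ?thesis by linarith
qed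

lemma integral_pair_swap:
  fixes h :: "'a::{second_countable_topology} \<times> 'b::{second_countable_topology} \<Rightarrow> real"
  assumes \<alpha>: "borel_prob \<alpha>" and \<beta>: "borel_prob \<beta>" and h: "h \<in> borel_measurable borel"
  shows "(\<integral>z. h z \<partial>(\<alpha> \<Otimes>\<^sub>M \<beta>)) = (\<integral>z. h (snd z, fst z) \<partial>(\<beta> \<Otimes>\<^sub>M \<alpha>))"
proof -
  interpret \<alpha>: prob_space \<alpha> using \<alpha> by (simp add: borel_prob_def)
  interpret \<beta>: prob_space \<beta> using \<beta> by (simp add: borel_prob_def)
  interpret S: pair_sigma_finite \<alpha> \<beta> ..
  have "h \<in> borel_measurable (\<alpha> \<Otimes>\<^sub>M \<beta>)"
    using h borel_prob_pair[OF \<alpha> \<beta>] by (simp add: borel_prob_def cong: measurable_cong_sets)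
  from S.integral_product_swap[OF this] show ?thesis
    by (simp add: case_prod_beta')
qed

lemma integral_pair_fst:
  fixes f :: "'a::topological_space \<Rightarrow> real"
  assumes \<alpha>: "borel_prob \<alpha>" and \<beta>: "borel_prob \<beta>" and f: "f \<in> borel_measurable borel"
  shows "(\<integral>z. f (fst z) \<partial>(\<alpha> \<Otimes>\<^sub>M \<beta>)) = (\<integral>x. f x \<partial>\<alpha>)"
proof -
  interpret \<beta>: prob_space \<beta> using \<beta> by (simp add: borel_prob_def)
  have "f \<in> borel_measurable \<alpha>"
    using f \<alpha> by (simp add: borel_prob_def cong: measurable_cong_sets)
  then have "(\<integral>x. f x \<partial>distr (\<alpha> \<Otimes>\<^sub>M \<beta>) \<alpha> fst) = (\<integral>z. f (fst z) \<partial>(\<alpha> \<Otimes>\<^sub>M \<beta>))"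
    by (intro integral_distr) auto
  then show ?thesis by (simp add: \<beta>.distr_pair_fst)
qed

lemma integral_pair_snd:
  fixes f :: "'b::{second_countable_topology} \<Rightarrow> real" and \<alpha> :: "'a::{second_countable_topology} measure"
  assumes \<alpha>: "borel_prob \<alpha>" and \<beta>: "borel_prob \<beta>" and f: "f \<in> borel_measurable borel"
  shows "(\<integral>z. f (snd z) \<partial>(\<alpha> \<Otimes>\<^sub>M \<beta>)) = (\<integral>y. f y \<partial>\<beta>)"
proof -
  have "(\<lambda>z. f (snd z)) \<in> borel_measurable (borel :: ('a \<times> 'b) measure)"
    using f by (simp add: borel_prod[symmetric])
  from integral_pair_swap[OF \<alpha> \<beta> this] integral_pair_fst[OF \<beta> \<alpha> f] show ?thesis by simp
qed

text \<open>A law that is close to some product \<open>\<alpha> \<Otimes>\<^sub>M \<beta>\<close> is close to the product of its own marginals. The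
  marginals enter through the functions \<open>z \<mapsto> h (fst z, y)\<close> and \<open>z \<mapsto> h (x, snd z)\<close>, which have the same bound
  and the same modulus of continuity as \<open>h\<close>, so that \<open>\<alpha>\<close> and \<open>\<beta>\<close> can be exchanged for the marginals
  one at a time.\<close>

lemma integral_joint_near_marginals:
  fixes P :: "('a::{metric_space, second_countable_topology} \<times> 'b::{metric_space, second_countable_topology}) measure"
  assumes P: "borel_prob P" and \<alpha>: "borel_prob \<alpha>" and \<beta>: "borel_prob \<beta>" and "0 < \<epsilon>"
    and nbhd: "\<And>A. closed A \<Longrightarrow> measure P A \<le> measure (\<alpha> \<Otimes>\<^sub>M \<beta>) (metric_nbhd sum_metric A \<epsilon>) + \<epsilon>"
    and h: "continuous_on UNIV h" and C: "0 < C" and hC: "\<And>z. \<bar>h z\<bar> \<le> C"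
    and modulus: "\<And>z w. mdist sum_metric z w < \<epsilon> \<Longrightarrow> \<bar>h z - h w\<bar> \<le> \<omega>"
  shows "\<bar>(\<integral>z. h z \<partial>P) - (\<integral>z. h z \<partial>(distr P borel fst \<Otimes>\<^sub>M distr P borel snd))\<bar> \<le> 3 * (\<omega> + 4 * C * \<epsilon>)"
proof -
  define \<eta> where "\<eta> = \<omega> + 4 * C * \<epsilon>"
  define \<alpha>' where "\<alpha>' = distr P borel fst"
  define \<beta>' where "\<beta>' = distr P borel snd"
  have sets: "sets P = sets (borel \<Otimes>\<^sub>M borel)" using P by (simp add: borel_prob_def borel_prod[symmetric])
  have m: "fst \<in> P \<rightarrow>\<^sub>M borel" "snd \<in> P \<rightarrow>\<^sub>M borel"
    by (simp_all add: measurable_cong_sets[OF sets refl])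
  have \<alpha>': "borel_prob \<alpha>'" and \<beta>': "borel_prob \<beta>'"
    using P m by (auto simp: \<alpha>'_def \<beta>'_def borel_prob_def prob_space.prob_space_distr)
  have near: "\<bar>(\<integral>z. g z \<partial>P) - (\<integral>z. g z \<partial>(\<alpha> \<Otimes>\<^sub>M \<beta>))\<bar> \<le> \<eta>"
    if "continuous_on UNIV g" "\<And>z. \<bar>g z\<bar> \<le> C" "\<And>z w. mdist sum_metric z w < \<epsilon> \<Longrightarrow> \<bar>g z - g w\<bar> \<le> \<omega>" for g
    unfolding \<eta>_def
    by (rule integral_near_of_nbhd_le[OF P borel_prob_pair[OF \<alpha> \<beta>] \<open>0 < \<epsilon>\<close> mspace_sum_metric nbhd that(1) C that(2) that(3)])
  have hm: "h \<in> borel_measurable borel" using h by (rule borel_measurable_continuous_onI)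
  have near_fst: "\<bar>(\<integral>x. h (x, y) \<partial>\<alpha>) - (\<integral>x. h (x, y) \<partial>\<alpha>')\<bar> \<le> \<eta>" for y
  proof -
    have c: "continuous_on UNIV (\<lambda>x. h (x, y))"
      by (rule continuous_on_compose2[OF h]) (intro continuous_intros subset_UNIV)+
    have c': "continuous_on UNIV (\<lambda>z :: 'a \<times> 'b. h (fst z, y))"
      by (rule continuous_on_compose2[OF h]) (intro continuous_intros subset_UNIV)+
    note b = borel_measurable_continuous_onI[OF c]
    have "\<bar>(\<integral>z. h (fst z, y) \<partial>P) - (\<integral>z. h (fst z, y) \<partial>(\<alpha> \<Otimes>\<^sub>M \<beta>))\<bar> \<le> \<eta>"
    proof (rule near[OF c' hC])
      fix z w :: "'a \<times> 'b" assume "mdist sum_metric z w < \<epsilon>"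
      then have "dist (fst z) (fst w) + dist (snd z) (snd w) < \<epsilon>" by simp
      then have "mdist sum_metric (fst z, y) (fst w, y) < \<epsilon>" by (simp add: order_le_less_trans[rotated])
      then show "\<bar>h (fst z, y) - h (fst w, y)\<bar> \<le> \<omega>" by (rule modulus)
    qed
    moreover have "(\<integral>z. h (fst z, y) \<partial>P) = (\<integral>x. h (x, y) \<partial>\<alpha>')"
      unfolding \<alpha>'_def by (rule integral_distr[OF m(1) b, symmetric])
    ultimately show ?thesis using integral_pair_fst[OF \<alpha> \<beta> b] by (simp add: abs_minus_commute)
  qed
  have near_snd: "\<bar>(\<integral>y. h (x, y) \<partial>\<beta>) - (\<integral>y. h (x, y) \<partial>\<beta>')\<bar> \<le> \<eta>" for x
  proof -
    have c: "continuous_on UNIV (\<lambda>y. h (x, y))"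
      by (rule continuous_on_compose2[OF h]) (intro continuous_intros subset_UNIV)+
    have c': "continuous_on UNIV (\<lambda>z :: 'a \<times> 'b. h (x, snd z))"
      by (rule continuous_on_compose2[OF h]) (intro continuous_intros subset_UNIV)+
    note b = borel_measurable_continuous_onI[OF c]
    have "\<bar>(\<integral>z. h (x, snd z) \<partial>P) - (\<integral>z. h (x, snd z) \<partial>(\<alpha> \<Otimes>\<^sub>M \<beta>))\<bar> \<le> \<eta>"
    proof (rule near[OF c' hC])
      fix z w :: "'a \<times> 'b" assume "mdist sum_metric z w < \<epsilon>"
      then have "dist (fst z) (fst w) + dist (snd z) (snd w) < \<epsilon>" by simp
      then have "mdist sum_metric (x, snd z) (x, snd w) < \<epsilon>" by (simp add: order_le_less_trans[rotated])
      then show "\<bar>h (x, snd z) - h (x, snd w)\<bar> \<le> \<omega>" by (rule modulus)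
    qed
    moreover have "(\<integral>z. h (x, snd z) \<partial>P) = (\<integral>y. h (x, y) \<partial>\<beta>')"
      unfolding \<beta>'_def by (rule integral_distr[OF m(2) b, symmetric])
    ultimately show ?thesis using integral_pair_snd[OF \<alpha> \<beta> b] by (simp add: abs_minus_commute)
  qed
  have "\<bar>(\<integral>z. h z \<partial>P) - (\<integral>z. h z \<partial>(\<alpha> \<Otimes>\<^sub>M \<beta>))\<bar> \<le> \<eta>"
    by (rule near[OF h hC modulus])
  moreover have "\<bar>(\<integral>z. h z \<partial>(\<alpha> \<Otimes>\<^sub>M \<beta>)) - (\<integral>z. h z \<partial>(\<alpha>' \<Otimes>\<^sub>M \<beta>))\<bar> \<le> \<eta>"
    by (rule integral_pair_fst_near[OF \<alpha> \<alpha>' \<beta> hm hC near_fst])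
  moreover have "\<bar>(\<integral>z. h z \<partial>(\<alpha>' \<Otimes>\<^sub>M \<beta>)) - (\<integral>z. h z \<partial>(\<alpha>' \<Otimes>\<^sub>M \<beta>'))\<bar> \<le> \<eta>"
  proof -
    have sm: "(\<lambda>z. h (snd z, fst z)) \<in> borel_measurable borel"
      by (intro borel_measurable_continuous_onI continuous_on_compose2[OF h] continuous_intros subset_UNIV)
    show ?thesis
      unfolding integral_pair_swap[OF \<alpha>' \<beta> hm] integral_pair_swap[OF \<alpha>' \<beta>' hm]
      by (rule integral_pair_fst_near[OF \<beta> \<beta>' \<alpha>' sm hC]) (use near_snd in simp)
  qed
  ultimately show ?thesis unfolding \<alpha>'_def[symmetric] \<beta>'_def[symmetric] \<eta>_def[symmetric] by linarith
qed

theorem proposition2: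
  fixes M :: "'w measure"
    and X :: "nat \<Rightarrow> 'w \<Rightarrow> 'a::polish_space"
    and Y :: "nat \<Rightarrow> 'w \<Rightarrow> 'b::polish_space"
  assumes "prob_space M"
    and "\<And>n. X n \<in> M \<rightarrow>\<^sub>M borel"
    and "\<And>n. Y n \<in> M \<rightarrow>\<^sub>M borel"
  shows "AI1 M X Y \<longleftrightarrow>
    (\<lambda>n. INF \<nu>\<in>product_laws. levy_prokhorov sum_metric (joint_law M (X n) (Y n)) \<nu>)
      \<longlonglongrightarrow> 0"
proof -
  define P where "P n = joint_law M (X n) (Y n)" for n
  define Q where "Q n = distr M borel (X n) \<Otimes>\<^sub>M distr M borel (Y n)" for n
  have XY: "(\<lambda>\<omega>. (X n \<omega>, Y n \<omega>)) \<in> M \<rightarrow>\<^sub>M borel \<Otimes>\<^sub>M borel" for n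
    using assms(2,3) by simp
  have P: "borel_prob (P n)" for n
    using assms(1) XY by (simp add: borel_prob_def P_def joint_law_def prob_space.prob_space_distr borel_prod)
  have lawX: "borel_prob (distr M borel (X n))" and lawY: "borel_prob (distr M borel (Y n))" for n
    using assms borel_prob_distr by blast+
  have Q: "borel_prob (Q n)" for n unfolding Q_def using lawX lawY by (rule borel_prob_pair)
  have Q_mem: "Q n \<in> product_laws" for n
    using lawX[of n] lawY[of n] unfolding product_laws_def Q_def borel_prob_def by blast
  have nonneg: "0 \<le> levy_prokhorov sum_metric (P n) \<nu>" for n \<nu>
    using P by (intro levy_prokhorov_nonneg) (simp add: borel_prob_def)
  have bdd: "bdd_below (levy_prokhorov sum_metric (P n) ` product_laws)" for n
    using nonneg by (intro bdd_belowI2)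
  define I where "I n = (INF \<nu>\<in>product_laws. levy_prokhorov sum_metric (P n) \<nu>)" for n
  have I0: "0 \<le> I n" for n
    unfolding I_def using Q_mem nonneg by (intro cINF_greatest) auto
  have AI: "AI1 M X Y \<longleftrightarrow> (\<forall>h :: 'a \<times> 'b \<Rightarrow> real.
      bounded (range h) \<and> uniformly_continuous_map sum_metric euclidean_metric h \<longrightarrow>
      (\<lambda>n. (\<integral>z. h z \<partial>P n) - (\<integral>z. h z \<partial>Q n)) \<longlonglongrightarrow> 0)"
    by (simp add: AI1_def P_def Q_def)
  have "I \<longlonglongrightarrow> 0" if "AI1 M X Y"
  proof -
    have "lipschitz_close P Q"
      unfolding lipschitz_close_def
    proof (intro allI impI)
      fix h :: "'a \<times> 'b \<Rightarrow> real" and L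
      assume h: "L-lipschitz_on UNIV h \<and> bounded (range h)"
      have "uniformly_continuous_map sum_metric euclidean_metric h"
        unfolding uniformly_continuous_map_def
      proof (intro conjI allI impI)
        fix e :: real assume "0 < e"
        obtain d where d: "0 < d" "\<And>x y. dist y x < d \<Longrightarrow> dist (h y) (h x) < e"
          using lipschitz_on_uniformly_continuous[of L UNIV h] h \<open>0 < e\<close>
          unfolding uniformly_continuous_on_def by (metis UNIV_I)
        have "dist x y \<le> dist (fst x) (fst y) + dist (snd x) (snd y)" for x y :: "'a \<times> 'b"
          unfolding dist_prod_def by (rule sqrt_sum_squares_le_sum) simp_all
        then show "\<exists>\<delta>>0. \<forall>x\<in>mspace sum_metric. \<forall>y\<in>mspace sum_metric.
            mdist sum_metric y x < \<delta> \<longrightarrow> mdist euclidean_metric (h y) (h x) < e"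
          using d by (auto intro!: exI[of _ d] simp del: split_paired_All) (meson order_le_less_trans)
      qed simp
      with h that show "(\<lambda>n. (\<integral>z. h z \<partial>P n) - (\<integral>z. h z \<partial>Q n)) \<longlonglongrightarrow> 0"
        unfolding AI by blast
    qed
    then have "(\<lambda>n. levy_prokhorov sum_metric (P n) (Q n)) \<longlonglongrightarrow> 0"
      using P Q by (intro levy_prokhorov_tendsto_0)
    moreover have "I n \<le> levy_prokhorov sum_metric (P n) (Q n)" for n
      unfolding I_def by (rule cINF_lower[OF bdd Q_mem])
    ultimately show ?thesis
      using I0 by (intro tendsto_sandwich[of "\<lambda>_. 0" I sequentially]) auto
  qed
  moreover have "AI1 M X Y" if lim: "I \<longlonglongrightarrow> 0"
    unfolding AI
  proof (intro allI impI LIMSEQ_I)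
    fix h :: "'a \<times> 'b \<Rightarrow> real" and e :: real
    assume "bounded (range h) \<and> uniformly_continuous_map sum_metric euclidean_metric h" and "0 < e"
    then have bh: "bounded (range h)" and uc: "uniformly_continuous_map sum_metric euclidean_metric h" by auto
    obtain C where C: "0 < C" "\<And>z. \<bar>h z\<bar> \<le> C"
      using bh unfolding bounded_pos by auto
    \<comment> \<open>The final bound is \<open>3 * (\<omega> + 4 * C * \<epsilon>)\<close>; both terms in the parentheses are at most \<open>e / 12\<close>.\<close>
    obtain d where d: "0 < d" "\<And>z w. mdist sum_metric z w < d \<Longrightarrow> \<bar>h z - h w\<bar> \<le> e / 12"
    proof -
      have "0 < e / 12" using \<open>0 < e\<close> by simp
      with uc have "\<exists>d>0. \<forall>w\<in>mspace sum_metric. \<forall>z\<in>mspace sum_metric.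
          mdist sum_metric z w < d \<longrightarrow> mdist euclidean_metric (h z) (h w) < e / 12"
        unfolding uniformly_continuous_map_def by blast
      then show ?thesis using that by (auto simp: dist_real_def simp del: split_paired_All mdist_sum_metric intro: less_imp_le)
    qed
    have hc: "continuous_on UNIV h"
      using uniformly_continuous_imp_continuous_map[OF uc] by simp
    define \<delta> where "\<delta> = min d (e / (48 * C))"
    have "0 < \<delta>" using d C \<open>0 < e\<close> by (simp add: \<delta>_def)
    have "\<forall>\<^sub>F n in sequentially. I n < \<delta>" using lim \<open>0 < \<delta>\<close> by (rule order_tendstoD)
    then have "\<forall>\<^sub>F n in sequentially. norm ((\<integral>z. h z \<partial>P n) - (\<integral>z. h z \<partial>Q n) - 0) < e"
    proof eventually_elim
      case (elim n)
      then obtain \<nu> where \<nu>: "\<nu> \<in> product_laws" "levy_prokhorov sum_metric (P n) \<nu> < \<delta>"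
        unfolding I_def using Q_mem bdd by (subst (asm) cINF_less_iff) auto
      then obtain \<alpha> \<beta> where ab: "\<nu> = \<alpha> \<Otimes>\<^sub>M \<beta>" "borel_prob \<alpha>" "borel_prob \<beta>"
        unfolding product_laws_def borel_prob_def by blast
      have "prob_space (P n)" using P[of n] by (simp add: borel_prob_def)
      then obtain \<epsilon> where \<epsilon>: "0 < \<epsilon>" "\<epsilon> < \<delta>"
        "\<And>A. closed A \<Longrightarrow> measure (P n) A \<le> measure (\<alpha> \<Otimes>\<^sub>M \<beta>) (metric_nbhd sum_metric A \<epsilon>) + \<epsilon>"
        using levy_prokhorov_less_obtain[OF _ \<nu>(2)] unfolding ab(1) by (metis closed_closedin mtopology_of_sum_metric)
      have "distr (P n) borel fst = distr M borel (X n)" "distr (P n) borel snd = distr M borel (Y n)"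
        unfolding P_def joint_law_def using XY by (simp_all add: distr_distr comp_def)
      then have "\<bar>(\<integral>z. h z \<partial>P n) - (\<integral>z. h z \<partial>Q n)\<bar> \<le> 3 * (e / 12 + 4 * C * \<epsilon>)"
        using integral_joint_near_marginals[OF P ab(2,3) \<epsilon>(1) \<epsilon>(3) hc C d(2)] \<epsilon>(2)
        by (simp add: Q_def \<delta>_def)
      moreover have "4 * C * \<epsilon> \<le> e / 12"
        using \<epsilon>(2) C(1) by (simp add: \<delta>_def field_simps)
      ultimately show ?case using \<open>0 < e\<close> by simp
    qed
    then show "\<exists>N. \<forall>n\<ge>N. norm ((\<integral>z. h z \<partial>P n) - (\<integral>z. h z \<partial>Q n) - 0) < e"
      by (simp add: eventually_sequentially)
  qed
  ultimately show ?thesis unfolding I_def P_def by blast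
qed

end
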